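(* Let $X$ be a Tychonoff space, $p,q\in\{a,\sigma,\tau,R,\beta,d\}$, and $Q\in\{M^+,U,P\}$. If $X$ is universally $Q^\ast_{[p,q]}$-measurable (i.e. $Q_p(X)$ is a $C^\ast$-embedded subset of $Q_q(X)$), then $X$ is universally $M_{[p,q]}$-measurable (i.e. $M_p(X)$ is a $C$-embedded subset of $M_q(X)$).
   Context: $\beta X$ is the Stone–Čech compactification. For a compact Hausdorff space $K$, $M(K)$ is the dual of the Banach space $C(K)$ of real continuous functions with the sup-norm, taken with the weak$^\ast$ topology; its elements are identified with finite signed regular Borel measures on $K$. $U(K)$ is the closed unit ball of $M(K)$, $M^+(K)$ the set of nonnegative elements of $M(K)$, and $P(K)=\{\mu\in M^+(K):\mu(K)=1\}$. $|\mu|$ is the total variation. For a Tychonoff space $X$ define the following subsets of $M(\beta X)$. $M_d(X)$: those $\mu$ concentrated on some countable subset of $X$; $M_\beta(X)$: those $\mu$ concentrated on some compact subset of $X$; $M_R(X)$: those $\mu$ concentrated on some $\sigma$-compact subset of $X$; $M_\tau(X)$: those $\mu$ with $|\mu|(K)=0$ for all compact $K\subset\beta X\setminus X$; $M_\sigma(X)$: those $\mu$ with $|\mu|(K)=0$ for all compact $K\subset\beta X\setminus X$ of type $G_\delta$ in $\beta X$; $M_a(X)=M(\beta X)$. Here "$\mu$ is concentrated on $S$" means $|\mu|(\beta X\setminus S)=0$. For each index $p$: $M^+_p(X)=M_p(X)\cap M^+(\beta X)$, $U_p(X)=M_p(X)\cap U(\beta X)$, $P_p(X)=M_p(X)\cap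 P(\beta X)$. All these carry the subspace topology from $M(\beta X)$. A subset $A$ of a space $Z$ is $C$-embedded (resp. $C^\ast$-embedded) in $Z$ if every real continuous (resp. every bounded real continuous) function on $A$ extends to a continuous function on $Z$; in particular these notions presuppose $A\subset Z$. *)

theory Defs
  imports "HOL-Analysis.Analysis"
begin

section \<open>The Stone--Cech compactification\<close>

text \<open>
  \<open>\<beta>X\<close> is the closure of the canonical image of \<open>X\<close> in the cube \<open>[0,1]\<^sup>C\<close> with
  \<open>C = C(X,[0,1])\<close>. Functions are taken extensional on \<open>topspace X\<close>, so that \<open>C\<close> is the index
  set used in \<open>completely_regular_space_cube_embedding_explicit\<close>.
\<close>

definition unit_functions :: "'a topology \<Rightarrow> ('a \<Rightarrow> real) set" where
  "unit_functions X =
     {f \<in> extensional (topspace X). continuous_map X (top_of_set {0..1}) f}"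

definition unit_cube :: "'a topology \<Rightarrow> (('a \<Rightarrow> real) \<Rightarrow> real) topology" where
  "unit_cube X = product_topology (\<lambda>_. top_of_set {0..1}) (unit_functions X)"

definition sc_map :: "'a topology \<Rightarrow> 'a \<Rightarrow> (('a \<Rightarrow> real) \<Rightarrow> real)" where
  "sc_map X x = (\<lambda>f \<in> unit_functions X. f x)"

definition sc_image :: "'a topology \<Rightarrow> (('a \<Rightarrow> real) \<Rightarrow> real) set" where
  "sc_image X = sc_map X ` topspace X"

definition stone_cech :: "'a topology \<Rightarrow> (('a \<Rightarrow> real) \<Rightarrow> real) topology" where
  "stone_cech X = subtopology (unit_cube X) (unit_cube X closure_of sc_image X)"

definition tychonoff_space :: "'a topology \<Rightarrow> bool" where
  "tychonoff_space X \<longleftrightarrow> completely_regular_space X \<and> Hausdorff_space X"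

section \<open>Finite signed regular Borel measures\<close>

definition borel_sets :: "'b topology \<Rightarrow> 'b set set" where
  "borel_sets K = sigma_sets (topspace K) {U. openin K U}"

text \<open>
  A finite signed Borel measure is a real-valued set function that is countably additive on the
  Borel sets. It is normalised to be \<open>0\<close> elsewhere, so that equality of set functions is
  equality of measures.
\<close>

definition signed_borel_measure :: "'b topology \<Rightarrow> ('b set \<Rightarrow> real) \<Rightarrow> bool" where
  "signed_borel_measure K \<mu> \<longleftrightarrow>
     (\<forall>A. A \<notin> borel_sets K \<longrightarrow> \<mu> A = 0) \<and>
     (\<forall>A :: nat \<Rightarrow> 'b set. range A \<subseteq> borel_sets K \<and> disjoint_family A
         \<longrightarrow> (\<lambda>n. \<mu> (A n)) sums \<mu> (\<Union>n. A n))"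

text \<open>
  Jordan decomposition \<open>\<mu> = \<mu>\<^sup>+ - \<mu>\<^sup>-\<close>, with \<open>\<mu>\<^sup>+(A) = sup {\<mu>(B) | B \<subseteq> A Borel}\<close> and
  \<open>\<mu>\<^sup>- = (-\<mu>)\<^sup>+\<close>. Truncating negative values by \<open>ennreal\<close> does not change the supremum,
  as \<open>B = {}\<close> contributes \<open>0\<close>.
\<close>

definition pos_variation :: "'b topology \<Rightarrow> ('b set \<Rightarrow> real) \<Rightarrow> 'b measure" where
  "pos_variation K \<mu> = measure_of (topspace K) (borel_sets K)
     (\<lambda>A. SUP B \<in> {B \<in> borel_sets K. B \<subseteq> A}. ennreal (\<mu> B))"

definition neg_variation :: "'b topology \<Rightarrow> ('b set \<Rightarrow> real) \<Rightarrow> 'b measure" where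
  "neg_variation K \<mu> = pos_variation K (\<lambda>A. - \<mu> A)"

definition total_variation :: "'b topology \<Rightarrow> ('b set \<Rightarrow> real) \<Rightarrow> 'b set \<Rightarrow> ennreal" where
  "total_variation K \<mu> A = emeasure (pos_variation K \<mu>) A + emeasure (neg_variation K \<mu>) A"

definition regular_signed_measure :: "'b topology \<Rightarrow> ('b set \<Rightarrow> real) \<Rightarrow> bool" where
  "regular_signed_measure K \<mu> \<longleftrightarrow>
     (\<forall>A \<in> borel_sets K. \<forall>e > 0. \<exists>F G. closedin K F \<and> openin K G \<and> F \<subseteq> A \<and> A \<subseteq> G \<and>
         total_variation K \<mu> (G - F) < ennreal e)"

definition signed_integral :: "'b topology \<Rightarrow> ('b set \<Rightarrow> real) \<Rightarrow> ('b \<Rightarrow> real) \<Rightarrow> real" where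
  "signed_integral K \<mu> f =
     (LINT x|pos_variation K \<mu>. f x) - (LINT x|neg_variation K \<mu>. f x)"

definition signed_measures :: "'b topology \<Rightarrow> ('b set \<Rightarrow> real) set" where
  "signed_measures K = {\<mu>. signed_borel_measure K \<mu> \<and> regular_signed_measure K \<mu>}"

text \<open>
  Under the Riesz identification \<open>\<mu> \<mapsto> (f \<mapsto> \<integral>f d\<mu>)\<close> of \<open>M(K)\<close> with the dual of \<open>C(K)\<close>, the
  weak* topology is the topology of pointwise convergence on \<open>C(K)\<close>.
\<close>

definition weak_star_topology :: "'b topology \<Rightarrow> ('b set \<Rightarrow> real) topology" where
  "weak_star_topology K =
     pullback_topology (signed_measures K)
       (\<lambda>\<mu>. \<lambda>f \<in> {f. continuous_map K euclideanreal f}. signed_integral K \<mu> f)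
       (product_topology (\<lambda>_. euclideanreal) {f. continuous_map K euclideanreal f})"

definition nonneg_measures :: "'b topology \<Rightarrow> ('b set \<Rightarrow> real) set" where
  "nonneg_measures K = {\<mu> \<in> signed_measures K. \<forall>A \<in> borel_sets K. 0 \<le> \<mu> A}"

text \<open>The closed unit ball for the norm dual to the sup-norm of \<open>C(K)\<close>.\<close>

definition unit_ball_measures :: "'b topology \<Rightarrow> ('b set \<Rightarrow> real) set" where
  "unit_ball_measures K =
     {\<mu> \<in> signed_measures K.
        \<forall>f. continuous_map K euclideanreal f \<and> (\<forall>x \<in> topspace K. \<bar>f x\<bar> \<le> 1)
            \<longrightarrow> \<bar>signed_integral K \<mu> f\<bar> \<le> 1}"

definition prob_measures :: "'b topology \<Rightarrow> ('b set \<Rightarrow> real) set" where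
  "prob_measures K = {\<mu> \<in> nonneg_measures K. \<mu> (topspace K) = 1}"

definition concentrated_on :: "'b topology \<Rightarrow> ('b set \<Rightarrow> real) \<Rightarrow> 'b set \<Rightarrow> bool" where
  "concentrated_on K \<mu> S \<longleftrightarrow> total_variation K \<mu> (topspace K - S) = 0"

section \<open>Classes of measures on a Tychonoff space\<close>

datatype measure_index = Idx_a | Idx_\<sigma> | Idx_\<tau> | Idx_R | Idx_\<beta> | Idx_d

fun M_class :: "measure_index \<Rightarrow> 'a topology \<Rightarrow> ((('a \<Rightarrow> real) \<Rightarrow> real) set \<Rightarrow> real) set" where
  "M_class Idx_a X = signed_measures (stone_cech X)"
| "M_class Idx_\<sigma> X =
     {\<mu> \<in> signed_measures (stone_cech X).
        \<forall>K. compactin (stone_cech X) K \<and> K \<subseteq> topspace (stone_cech X) - sc_image X \<and>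
            gdelta_in (stone_cech X) K
            \<longrightarrow> total_variation (stone_cech X) \<mu> K = 0}"
| "M_class Idx_\<tau> X =
     {\<mu> \<in> signed_measures (stone_cech X).
        \<forall>K. compactin (stone_cech X) K \<and> K \<subseteq> topspace (stone_cech X) - sc_image X
            \<longrightarrow> total_variation (stone_cech X) \<mu> K = 0}"
| "M_class Idx_R X =
     {\<mu> \<in> signed_measures (stone_cech X).
        \<exists>\<K>. countable \<K> \<and> (\<forall>K \<in> \<K>. compactin (stone_cech X) K) \<and> \<Union>\<K> \<subseteq> sc_image X \<and>
            concentrated_on (stone_cech X) \<mu> (\<Union>\<K>)}"
| "M_class Idx_\<beta> X =
     {\<mu> \<in> signed_measures (stone_cech X).
        \<exists>K. compactin (stone_cech X) K \<and> K \<subseteq> sc_image X \<and>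
            concentrated_on (stone_cech X) \<mu> K}"
| "M_class Idx_d X =
     {\<mu> \<in> signed_measures (stone_cech X).
        \<exists>S. countable S \<and> S \<subseteq> sc_image X \<and> concentrated_on (stone_cech X) \<mu> S}"

datatype sub_functor = M_plus | U_ball | P_prob

fun sub_measures :: "sub_functor \<Rightarrow> 'b topology \<Rightarrow> ('b set \<Rightarrow> real) set" where
  "sub_measures M_plus K = nonneg_measures K"
| "sub_measures U_ball K = unit_ball_measures K"
| "sub_measures P_prob K = prob_measures K"

definition Q_class ::
  "sub_functor \<Rightarrow> measure_index \<Rightarrow> 'a topology \<Rightarrow> ((('a \<Rightarrow> real) \<Rightarrow> real) set \<Rightarrow> real) set" where
  "Q_class Q p X = M_class p X \<inter> sub_measures Q (stone_cech X)"

section \<open>Embedded subsets and universal measurability\<close>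

definition C_embedded :: "'b topology \<Rightarrow> 'b set \<Rightarrow> bool" where
  "C_embedded Z A \<longleftrightarrow> A \<subseteq> topspace Z \<and>
     (\<forall>f. continuous_map (subtopology Z A) euclideanreal f
        \<longrightarrow> (\<exists>g. continuous_map Z euclideanreal g \<and> (\<forall>x \<in> A. g x = f x)))"

definition C_star_embedded :: "'b topology \<Rightarrow> 'b set \<Rightarrow> bool" where
  "C_star_embedded Z A \<longleftrightarrow> A \<subseteq> topspace Z \<and>
     (\<forall>f. continuous_map (subtopology Z A) euclideanreal f \<and> bounded (f ` A)
        \<longrightarrow> (\<exists>g. continuous_map Z euclideanreal g \<and> (\<forall>x \<in> A. g x = f x)))"

definition universally_Q_star_measurable ::
  "sub_functor \<Rightarrow> measure_index \<Rightarrow> measure_index \<Rightarrow> 'a topology \<Rightarrow> bool" where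
  "universally_Q_star_measurable Q p q X \<longleftrightarrow>
     C_star_embedded (subtopology (weak_star_topology (stone_cech X)) (Q_class Q q X))
       (Q_class Q p X)"

definition universally_M_measurable ::
  "measure_index \<Rightarrow> measure_index \<Rightarrow> 'a topology \<Rightarrow> bool" where
  "universally_M_measurable p q X \<longleftrightarrow>
     C_embedded (subtopology (weak_star_topology (stone_cech X)) (M_class q X)) (M_class p X)"

end

theory Submission
  imports Defs
begin

text \<open>
  Let \<open>\<mu> \<in> P\<^sub>q(X)\<close> and let \<open>D\<close> be a continuous pseudometric distance to \<open>\<mu>\<close> built from countably
  many \<open>\<phi>\<^sub>n \<in> C(\<beta>X)\<close>. If \<open>D\<close> had no zero on \<open>Q\<^sub>p(X)\<close>, then \<open>sin (1 / D)\<close> would be a bounded continuous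
  function there. It has no continuous extension to \<open>\<mu>\<close>: every convex neighbourhood of \<open>\<mu>\<close> contains
  a segment in \<open>P\<^sub>p(X)\<close> (finitely supported measures are dense) along which it takes both values \<open>1\<close>
  and \<open>-1\<close>. Hence some \<open>\<nu> \<in> Q\<^sub>p(X)\<close> agrees with \<open>\<mu>\<close> on all \<open>\<phi>\<^sub>n\<close>, and by the Jordan decomposition the
  same holds for \<open>\<mu> \<in> M\<^sub>q(X)\<close> with \<open>\<nu> \<in> M\<^sub>p(X)\<close>.

  A continuous function \<open>f\<close> on the linear space \<open>M\<^sub>p(X)\<close> is already continuous for the topology induced
  by countably many functions of \<open>C(\<beta>X)\<close>. It extends to \<open>M\<^sub>q(X)\<close> by \<open>\<mu> \<mapsto> f \<nu>\<close>, where \<open>\<nu> \<in> M\<^sub>p(X)\<close> agrees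
  with \<open>\<mu>\<close> on these functions.
\<close>

section \<open>Continuous functions on weak linear spaces depend on countably many coordinates\<close>

text \<open>The hypothesis concerns bounded functions on sets that need not be linear, the
  conclusion arbitrary functions on linear spaces, so a given \<open>f\<close> is never restricted
  to Q and extended from there. Only two consequences of the hypothesis enter: the inclusion of the
  classes, and the fact that the class p meets every nonempty G-delta subset of the class q, which
  is what agreement on countably many integrals says. The natural witness against a missing
  agreement, \<open>1 / D\<close>, is unbounded; composing it with the sine makes it bounded, but
  forbids an extension only if \<open>D\<close> runs through whole intervals near
  \<open>\<mu>\<close>, hence the segments. Probability measures serve all three choices of Q at
  once: they lie in each Q, are convex, and generate all of M by scaling and subtraction. As for the
  other half, C(beta X) is in general not separable; what confines a continuous function to
  countably many coordinates is a dichotomy of linear spaces: a coordinate is either a linear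
  combination of finitely many given ones or can be moved freely while finitely many are held
  fixed.\<close>

locale evaluation_pairing =
  fixes Y :: "'y set" and ev :: "'y \<Rightarrow> 'i \<Rightarrow> real"
begin

definition weak_ball :: "'y \<Rightarrow> 'i set \<Rightarrow> real \<Rightarrow> 'y set" where
  "weak_ball y F d = {u \<in> Y. \<forall>i\<in>F. \<bar>ev u i - ev y i\<bar> < d}"

text \<open>\<open>J\<close> is a parameter because the section shrinks it: from all of
  \<open>I\<close> to a countable subset over which \<open>f\<close> is still continuous.\<close>

definition weakly_continuous :: "'i set \<Rightarrow> ('y \<Rightarrow> real) \<Rightarrow> bool" where
  "weakly_continuous J f \<longleftrightarrow> (\<forall>y\<in>Y. \<forall>e>0. \<exists>F d. finite F \<and> F \<subseteq> J \<and> 0 < d \<and>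
     (\<forall>u \<in> weak_ball y F d. \<bar>f u - f y\<bar> < e))"

lemma weakly_continuousE:
  assumes "weakly_continuous J f" "y \<in> Y" "0 < e"
  obtains F d where "finite F" "F \<subseteq> J" "0 < d" "\<forall>u \<in> weak_ball y F d. \<bar>f u - f y\<bar> < e"
proof -
  have "\<exists>F d. finite F \<and> F \<subseteq> J \<and> 0 < d \<and> (\<forall>u \<in> weak_ball y F d. \<bar>f u - f y\<bar> < e)"
    using assms(1)[unfolded weakly_continuous_def, THEN bspec, OF assms(2), THEN spec, of e] assms(3)
    by (rule mp)
  then show thesis by (elim exE conjE) (rule that)
qed

lemma weakly_continuous_uminus: "weakly_continuous J f \<Longrightarrow> weakly_continuous J (\<lambda>u. - f u)"
  unfolding weakly_continuous_def by (simp add: abs_minus_commute)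

end

text \<open>The type of \<open>Y\<close> has no vector operations, so closure under
  \<open>u + c * v\<close> is required of the evaluations only. Measures enter later, with
  integration as \<open>ev\<close>.\<close>

locale weak_linear_space = evaluation_pairing Y ev
  for Y :: "'y set" and I :: "'i set" and ev :: "'y \<Rightarrow> 'i \<Rightarrow> real" +
  assumes add_scale: "u \<in> Y \<Longrightarrow> v \<in> Y \<Longrightarrow> \<exists>w\<in>Y. \<forall>i\<in>I. ev w i = ev u i + c * ev v i"
begin

text \<open>Linearity relative to the same relation; with \<open>c = 0\<close> it also says that
  \<open>L\<close> depends only on the coordinates in \<open>I\<close>.\<close>

definition functional :: "('y \<Rightarrow> real) \<Rightarrow> bool" where
  "functional L \<longleftrightarrow> (\<forall>u\<in>Y. \<forall>v\<in>Y. \<forall>w\<in>Y. \<forall>c.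
     (\<forall>i\<in>I. ev w i = ev u i + c * ev v i) \<longrightarrow> L w = L u + c * L v)"

lemma functional_ev: "i \<in> I \<Longrightarrow> functional (\<lambda>u. ev u i)"
  by (auto simp: functional_def)

lemma functional_diff_scale:
  assumes "functional L" "functional M"
  shows "functional (\<lambda>u. L u - r * M u)"
  unfolding functional_def
proof (intro ballI allI impI)
  fix u v w c assume "u \<in> Y" "v \<in> Y" "w \<in> Y" "\<forall>i\<in>I. ev w i = ev u i + c * ev v i"
  then have "L w = L u + c * L v" "M w = M u + c * M v"
    using assms unfolding functional_def by blast+
  then show "L w - r * M w = L u - r * M u + c * (L v - r * M v)"
    by (simp add: algebra_simps)
qed

text \<open>Induction on \<open>H\<close>: a new coordinate \<open>h\<close> that vanishes on the
  common kernel of \<open>H\<close> is dropped; otherwise a suitable multiple of it is subtracted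
  from \<open>L\<close>, and the difference vanishes on that kernel.\<close>

lemma functional_in_span:
  assumes "finite H" "H \<subseteq> I" "functional L"
    and "\<And>u. u \<in> Y \<Longrightarrow> (\<forall>h\<in>H. ev u h = 0) \<Longrightarrow> L u = 0"
  shows "\<exists>c. \<forall>u\<in>Y. L u = (\<Sum>h\<in>H. c h * ev u h)"
  using assms
proof (induction H arbitrary: L rule: finite_induct)
  case empty
  then show ?case by auto
next
  case (insert h H)
  have span: "\<exists>r c. \<forall>u\<in>Y. L u = r * ev u h + (\<Sum>k\<in>H. c k * ev u k)"
  proof (cases "\<forall>u\<in>Y. (\<forall>k\<in>H. ev u k = 0) \<longrightarrow> ev u h = 0")
    case True
    then have "\<And>u. u \<in> Y \<Longrightarrow> (\<forall>k\<in>H. ev u k = 0) \<Longrightarrow> L u = 0"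
      using insert.prems(3) by auto
    with insert.IH[of L] insert.prems obtain c where "\<forall>u\<in>Y. L u = (\<Sum>k\<in>H. c k * ev u k)"
      by auto
    then show ?thesis by (intro exI[of _ 0] exI[of _ c]) auto
  next
    case False
    then obtain v where v: "v \<in> Y" "\<And>k. k \<in> H \<Longrightarrow> ev v k = 0" "ev v h \<noteq> 0" by auto
    \<comment> \<open>The only multiple for which the difference vanishes at
      \<open>v\<close>.\<close>
    define r where "r = L v / ev v h"
    have "functional (\<lambda>u. L u - r * ev u h)"
      using insert.prems by (intro functional_diff_scale functional_ev) auto
    moreover have "L u - r * ev u h = 0" if u: "u \<in> Y" "\<forall>k\<in>H. ev u k = 0" for u
    proof -
      \<comment> \<open>Moves \<open>u\<close> along \<open>v\<close> until coordinate
        \<open>h\<close> vanishes too; the coordinates in \<open>H\<close> stay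
        \<open>0\<close>.\<close>
      define c where "c = - (ev u h / ev v h)"
      obtain w where w: "w \<in> Y" "\<forall>i\<in>I. ev w i = ev u i + c * ev v i"
        using add_scale[OF u(1) v(1)] by blast
      have "\<forall>k\<in>insert h H. ev w k = 0"
        using w(2) u v insert.prems(1) by (auto simp: c_def subset_iff)
      then have "L w = 0" using insert.prems(3) w(1) by blast
      moreover have "L w = L u + c * L v"
        using insert.prems(2) u(1) v(1) w unfolding functional_def by blast
      ultimately show ?thesis by (simp add: c_def r_def)
    qed
    ultimately obtain c where "\<forall>u\<in>Y. L u - r * ev u h = (\<Sum>k\<in>H. c k * ev u k)"
      using insert.IH[of "\<lambda>u. L u - r * ev u h"] insert.prems(1) by auto
    then show ?thesis by (intro exI[of _ r] exI[of _ c]) (auto simp: algebra_simps)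
  qed
  then obtain r c where rc: "\<forall>u\<in>Y. L u = r * ev u h + (\<Sum>k\<in>H. c k * ev u k)" by blast
  have "(\<Sum>k\<in>H. (c(h := r)) k * ev u k) = (\<Sum>k\<in>H. c k * ev u k)" for u
    using insert.hyps by (intro sum.cong) auto
  with rc show ?case
    using insert.hyps by (intro exI[of _ "c(h := r)"]) auto
qed

text \<open>
  A coordinate in the span of \<open>A\<close> is controlled by finitely many coordinates in \<open>A\<close>; one outside the
  span can be adjusted without changing any given finite set of the others.
\<close>

lemma weak_ball_amalgamation:
  assumes "finite F" "F \<subseteq> I" "A \<subseteq> I" "y \<in> Y" "0 < d"
  shows "\<exists>F0 d0. finite F0 \<and> F0 \<subseteq> A \<and> 0 < d0 \<and>
     (\<forall>G u. finite G \<and> G \<subseteq> A \<and> u \<in> weak_ball y F0 d0 \<longrightarrow>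
        (\<exists>w \<in> weak_ball y F d. \<forall>i\<in>G. ev w i = ev u i))"
  using assms
proof (induction F arbitrary: d rule: finite_induct)
  case empty
  then show ?case
    by (intro exI[of _ "{}"] exI[of _ 1]) (auto simp: weak_ball_def)
next
  case (insert g F)
  show ?case
  proof (cases "\<exists>H. finite H \<and> H \<subseteq> A \<union> F \<and> (\<forall>u\<in>Y. (\<forall>h\<in>H. ev u h = 0) \<longrightarrow> ev u g = 0)")
    case False
    obtain F0 d0 where F0: "finite F0" "F0 \<subseteq> A" "0 < d0"
      and IH: "\<And>G u. finite G \<Longrightarrow> G \<subseteq> A \<Longrightarrow> u \<in> weak_ball y F0 d0 \<Longrightarrow>
        \<exists>w \<in> weak_ball y F d. \<forall>i\<in>G. ev w i = ev u i"
      using insert.IH[OF _ insert.prems(2-4)] insert.prems(1) by auto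
    have amalg: "\<exists>w \<in> weak_ball y (insert g F) d. \<forall>i\<in>G. ev w i = ev u i"
      if G: "finite G" "G \<subseteq> A" "u \<in> weak_ball y F0 d0" for G u
    proof -
      obtain w where w: "w \<in> weak_ball y F d" "\<And>i. i \<in> G \<Longrightarrow> ev w i = ev u i"
        using IH[OF G] by blast
      from False have "\<not> (\<forall>u\<in>Y. (\<forall>h\<in>G \<union> F. ev u h = 0) \<longrightarrow> ev u g = 0)"
        using G insert.hyps(1) by (metis finite_UnI Un_mono order_refl)
      then obtain v where v: "v \<in> Y" "\<And>h. h \<in> G \<union> F \<Longrightarrow> ev v h = 0" "ev v g \<noteq> 0" by auto
      \<comment> \<open>Makes coordinate \<open>g\<close> of \<open>w'\<close> equal to that of
        \<open>y\<close>, not merely close to it.\<close>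
      define c where "c = (ev y g - ev w g) / ev v g"
      obtain w' where w': "w' \<in> Y" "\<And>i. i \<in> I \<Longrightarrow> ev w' i = ev w i + c * ev v i"
        using add_scale[of w v c] w(1) v(1) unfolding weak_ball_def by blast
      have "w' \<in> weak_ball y (insert g F) d"
        using w' w(1) v insert.prems by (auto simp: weak_ball_def c_def subset_iff)
      moreover have "\<forall>i\<in>G. ev w' i = ev u i"
        using w' w(2) v(2) G(2) insert.prems(2) by auto
      ultimately show ?thesis by blast
    qed
    show ?thesis
      by (rule exI[of _ F0], rule exI[of _ d0]) (use F0 amalg in simp)
  next
    case True
    then obtain H where H: "finite H" "H \<subseteq> A \<union> F" "\<forall>u\<in>Y. (\<forall>h\<in>H. ev u h = 0) \<longrightarrow> ev u g = 0"
      by blast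
    have "\<exists>c. \<forall>u\<in>Y. ev u g = (\<Sum>h\<in>H. c h * ev u h)"
      using H insert.prems by (intro functional_in_span functional_ev) auto
    then obtain c where c: "\<And>u. u \<in> Y \<Longrightarrow> ev u g = (\<Sum>h\<in>H. c h * ev u h)" by blast
    \<comment> \<open>The summand \<open>1\<close> gives \<open>N \<ge> 1\<close>, hence
      \<open>d' \<le> d\<close>, and keeps the final estimate strict: the error is at most
      \<open>(N - 1) * d'\<close>, which is below \<open>N * d' = d\<close>.\<close>
    define N where "N = 1 + (\<Sum>h\<in>H. \<bar>c h\<bar>)"
    have N: "1 \<le> N" by (simp add: N_def sum_nonneg)
    define d' where "d' = d / N"
    have d': "0 < d'" "d' \<le> d"
      using N insert.prems(4) by (auto simp: d'_def field_simps)
    obtain F0 d0 where F0: "finite F0" "F0 \<subseteq> A" "0 < d0"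
      and IH: "\<And>G u. finite G \<Longrightarrow> G \<subseteq> A \<Longrightarrow> u \<in> weak_ball y F0 d0 \<Longrightarrow>
        \<exists>w \<in> weak_ball y F d'. \<forall>i\<in>G. ev w i = ev u i"
      using insert.IH[OF _ insert.prems(2,3) d'(1)] insert.prems(1) by auto
    \<comment> \<open>Coordinates of \<open>H\<close> outside \<open>A\<close> lie in
      \<open>F\<close> and are controlled by the induction hypothesis; those inside \<open>A\<close>
      must be controlled through \<open>u\<close>, with which \<open>w\<close> will agree
      there.\<close>
    define F1 where "F1 = F0 \<union> (H \<inter> A)"
    define d1 where "d1 = min d0 d'"
    have amalg: "\<exists>w \<in> weak_ball y (insert g F) d. \<forall>i\<in>G. ev w i = ev u i"
      if G: "finite G" "G \<subseteq> A" "u \<in> weak_ball y F1 d1" for G u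
    proof -
      have "u \<in> weak_ball y F0 d0" using G(3) by (auto simp: weak_ball_def F1_def d1_def)
      then obtain w where w: "w \<in> weak_ball y F d'" "\<And>i. i \<in> G \<union> (H \<inter> A) \<Longrightarrow> ev w i = ev u i"
        using IH[of "G \<union> (H \<inter> A)" u] G(1,2) H(1) by auto
      have wY: "w \<in> Y" using w(1) by (simp add: weak_ball_def)
      have h: "\<bar>ev w h - ev y h\<bar> \<le> d'" if "h \<in> H" for h
      proof (cases "h \<in> A")
        case True
        then have "h \<in> F1" "ev w h = ev u h" using that w(2)[of h] by (auto simp: F1_def)
        with G(3) have "\<bar>ev w h - ev y h\<bar> < d1" by (simp add: weak_ball_def)
        then show ?thesis by (simp add: d1_def)
      next
        case False
        then have "h \<in> F" using that H(2) by blast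
        then show ?thesis using w(1) by (simp add: weak_ball_def less_imp_le)
      qed
      have "\<bar>ev w g - ev y g\<bar> = \<bar>\<Sum>h\<in>H. c h * (ev w h - ev y h)\<bar>"
        using c[OF wY] c[OF insert.prems(3)] by (simp add: sum_subtractf algebra_simps)
      also have "\<dots> \<le> (\<Sum>h\<in>H. \<bar>c h\<bar> * d')"
        by (rule order_trans[OF sum_abs]) (auto intro!: sum_mono mult_left_mono h simp: abs_mult)
      also have "\<dots> = (N - 1) * d'" by (simp add: N_def sum_distrib_right)
      also have "\<dots> < N * d'" using d' by simp
      also have "\<dots> = d" using N by (simp add: d'_def)
      finally have "w \<in> weak_ball y (insert g F) d"
        using w(1) d' by (force simp: weak_ball_def)
      then show ?thesis using w(2) by blast
    qed
    have "finite F1" "F1 \<subseteq> A" "0 < d1"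
      using F0 H(1) d' by (auto simp: F1_def d1_def)
    then show ?thesis
      by (intro exI[of _ F1] exI[of _ d1]) (use amalg in simp)
  qed
qed

section \<open>Reflection of open sets to countably many coordinates\<close>

definition weakly_open :: "'y set \<Rightarrow> bool" where
  "weakly_open U \<longleftrightarrow> U \<subseteq> Y \<and>
     (\<forall>y\<in>U. \<exists>F d. finite F \<and> F \<subseteq> I \<and> 0 < d \<and> weak_ball y F d \<subseteq> U)"

text \<open>Rational endpoints leave only countably many finite boxes over a countable set of
  coordinates, so closing under witnesses stays countable.\<close>

definition rational_box :: "('i \<times> rat \<times> rat) set \<Rightarrow> 'y set" where
  "rational_box T = {u \<in> Y. \<forall>(i, a, b)\<in>T. of_rat a < ev u i \<and> ev u i < of_rat b}"

text \<open>
  A Loewenheim--Skolem closure replaces the usual appeal to the countable chain condition: whenever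
  \<open>U\<close> meets a rational box over \<open>A\<close>, it does so at a point whose membership in \<open>U\<close> is decided by
  finitely many coordinates in \<open>A\<close>.
\<close>

lemma countable_reflecting_set:
  assumes U: "weakly_open U"
  shows "\<exists>A. countable A \<and> A \<subseteq> I \<and>
    (\<forall>T. finite T \<and> T \<subseteq> A \<times> UNIV \<and> U \<inter> rational_box T \<noteq> {} \<longrightarrow>
       (\<exists>G u. finite G \<and> G \<subseteq> A \<and> u \<in> U \<inter> rational_box T \<and> (\<forall>w\<in>Y. (\<forall>i\<in>G. ev w i = ev u i) \<longrightarrow> w \<in> U)))"
proof -
  have "\<exists>G. finite G \<and> G \<subseteq> I \<and> (U \<inter> rational_box T \<noteq> {} \<longrightarrow> (\<exists>u \<in> U \<inter> rational_box T. \<forall>w\<in>Y. (\<forall>i\<in>G. ev w i = ev u i) \<longrightarrow> w \<in> U))" for T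
  proof (cases "U \<inter> rational_box T = {}")
    case False
    then obtain u where u: "u \<in> U \<inter> rational_box T" by blast
    then obtain F d where F: "finite F" "F \<subseteq> I" "0 < d" "weak_ball u F d \<subseteq> U"
      using U unfolding weakly_open_def by blast
    have "\<forall>w\<in>Y. (\<forall>i\<in>F. ev w i = ev u i) \<longrightarrow> w \<in> U"
      using F by (auto simp: weak_ball_def)
    with u F show ?thesis by blast
  qed auto
  then have "\<exists>g. \<forall>T. finite (g T) \<and> g T \<subseteq> I \<and> (U \<inter> rational_box T \<noteq> {} \<longrightarrow>
      (\<exists>u \<in> U \<inter> rational_box T. \<forall>w\<in>Y. (\<forall>i\<in>g T. ev w i = ev u i) \<longrightarrow> w \<in> U))"
    by (intro choice allI)
  then obtain g where g: "\<And>T. finite (g T)" "\<And>T. g T \<subseteq> I"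
    "\<And>T. U \<inter> rational_box T \<noteq> {} \<Longrightarrow> \<exists>u \<in> U \<inter> rational_box T. \<forall>w\<in>Y. (\<forall>i\<in>g T. ev w i = ev u i) \<longrightarrow> w \<in> U"
    by blast
  \<comment> \<open>Stage \<open>n + 1\<close> adds deciding coordinates for every box over stage
    \<open>n\<close>; omega stages suffice because a box imposes finitely many conditions.\<close>
  define B where "B = rec_nat {} (\<lambda>_ C. C \<union> (\<Union>T \<in> {T. T \<subseteq> C \<times> UNIV \<and> finite T}. g T))"
  have B0: "B 0 = {}" and BS: "\<And>n. B (Suc n) = B n \<union> (\<Union>T \<in> {T. T \<subseteq> B n \<times> UNIV \<and> finite T}. g T)"
    by (auto simp: B_def)
  have cB: "countable (B n)" for n
  proof (induction n)
    case (Suc n)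
    have "countable {T. T \<subseteq> B n \<times> (UNIV :: (rat \<times> rat) set) \<and> finite T}"
      using countable_Collect_finite_subset[OF countable_SIGMA[OF Suc countableI_type]] by (simp add: conj_commute)
    then show ?case
      unfolding BS using Suc g(1) by (intro countable_Un countable_UN) (auto intro: countable_finite)
  qed (simp add: B0)
  have BI: "B n \<subseteq> I" for n
    by (induction n) (use g(2) in \<open>auto simp: B0 BS\<close>)
  have mono: "mono B" by (auto simp: mono_iff_le_Suc BS)
  show ?thesis
  proof (rule exI[of _ "\<Union>n. B n"], intro conjI allI impI)
    fix T :: "('i \<times> rat \<times> rat) set"
    assume T: "finite T \<and> T \<subseteq> (\<Union>n. B n) \<times> UNIV \<and> U \<inter> rational_box T \<noteq> {}"
    have "\<exists>n. fst ` T \<subseteq> B n"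
    proof -
      have "finite (fst ` T)" "fst ` T \<subseteq> \<Union>(range B)" using T by auto
      moreover have "\<exists>C. X \<subseteq> B C" if "finite X" "X \<subseteq> \<Union>(range B)" for X
        using that
      proof (induction X rule: finite_induct)
        case (insert x X)
        then obtain m n where "X \<subseteq> B m" "x \<in> B n" by auto
        then have "insert x X \<subseteq> B (max m n)"
          using monoD[OF mono, of m "max m n"] monoD[OF mono, of n "max m n"] by auto
        then show ?case by blast
      qed auto
      ultimately show ?thesis by blast
    qed
    then obtain n where "fst ` T \<subseteq> B n" by blast
    then have "T \<subseteq> B n \<times> UNIV" by force
    then have "g T \<subseteq> B (Suc n)" using T by (auto simp: BS)
    then have "g T \<subseteq> (\<Union>n. B n)" by blast
    moreover have "U \<inter> rational_box T \<noteq> {}" using T by blast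
    from g(3)[OF this] obtain u where "u \<in> U \<inter> rational_box T" "\<forall>w\<in>Y. (\<forall>i\<in>g T. ev w i = ev u i) \<longrightarrow> w \<in> U"
      by blast
    ultimately show "\<exists>G u. finite G \<and> G \<subseteq> (\<Union>n. B n) \<and> u \<in> U \<inter> rational_box T \<and> (\<forall>w\<in>Y. (\<forall>i\<in>G. ev w i = ev u i) \<longrightarrow> w \<in> U)"
      using g(1)[of T] by (intro exI[of _ "g T"] exI[of _ u]) simp
  qed (use cB BI in auto)
qed

text \<open>Take the ball over \<open>A\<close> that amalgamation provides for the given separating
  ball. If it met \<open>U\<close>, reflection would give a point of \<open>U\<close> in it whose
  membership in \<open>U\<close> depends on finitely many coordinates in \<open>A\<close>;
  amalgamation copies these coordinates into the separating ball, which would then meet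
  \<open>U\<close>.\<close>

lemma closure_determined_by_countable:
  assumes U: "weakly_open U"
  shows "\<exists>A. countable A \<and> A \<subseteq> I \<and>
    (\<forall>y\<in>Y. (\<exists>F d. finite F \<and> F \<subseteq> I \<and> 0 < d \<and> weak_ball y F d \<inter> U = {}) \<longrightarrow>
       (\<exists>F d. finite F \<and> F \<subseteq> A \<and> 0 < d \<and> weak_ball y F d \<inter> U = {}))"
proof -
  obtain A where A: "countable A" "A \<subseteq> I"
    and refl: "\<forall>T. finite T \<and> T \<subseteq> A \<times> UNIV \<and> U \<inter> rational_box T \<noteq> {} \<longrightarrow>
       (\<exists>G u. finite G \<and> G \<subseteq> A \<and> u \<in> U \<inter> rational_box T \<and> (\<forall>w\<in>Y. (\<forall>i\<in>G. ev w i = ev u i) \<longrightarrow> w \<in> U))"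
    using countable_reflecting_set[OF U] by (elim exE conjE) (rule that)
  have sep: "\<exists>F d. finite F \<and> F \<subseteq> A \<and> 0 < d \<and> weak_ball y F d \<inter> U = {}"
    if y: "y \<in> Y" and F: "finite F" "F \<subseteq> I" "0 < d" "weak_ball y F d \<inter> U = {}" for y F d
  proof -
    obtain F0 d0 where F0: "finite F0" "F0 \<subseteq> A" "0 < d0"
      and amalg: "\<forall>G u. finite G \<and> G \<subseteq> A \<and> u \<in> weak_ball y F0 d0 \<longrightarrow>
        (\<exists>w \<in> weak_ball y F d. \<forall>i\<in>G. ev w i = ev u i)"
      using weak_ball_amalgamation[OF F(1,2) A(2) y F(3)] by (elim exE conjE) (rule that)
    have "weak_ball y F0 d0 \<inter> U = {}"
    proof (rule ccontr)
      assume "weak_ball y F0 d0 \<inter> U \<noteq> {}"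
      then obtain u where u: "u \<in> U" "u \<in> Y" "\<And>i. i \<in> F0 \<Longrightarrow> \<bar>ev u i - ev y i\<bar> < d0"
        by (auto simp: weak_ball_def)
      \<comment> \<open>A rational box squeezed between \<open>u\<close> and the ball: every point
        of the box is again within \<open>d0\<close> of \<open>y\<close> on
        \<open>F0\<close>.\<close>
      have "\<exists>a b. ev y i - d0 < of_rat a \<and> of_rat a < ev u i \<and> ev u i < of_rat b \<and> of_rat b < ev y i + d0"
        if "i \<in> F0" for i
        using u(3)[OF that] of_rat_dense[of "ev y i - d0" "ev u i"] of_rat_dense[of "ev u i" "ev y i + d0"]
        by (auto simp: abs_less_iff)
      then obtain a b where ab: "\<And>i. i \<in> F0 \<Longrightarrow>
          ev y i - d0 < of_rat (a i) \<and> of_rat (a i) < ev u i \<and> ev u i < of_rat (b i) \<and> of_rat (b i) < ev y i + d0"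
        by metis
      define T where "T = (\<lambda>i. (i, a i, b i)) ` F0"
      have "u \<in> U \<inter> rational_box T"
        using u(1,2) ab by (simp add: rational_box_def T_def)
      then have "U \<inter> rational_box T \<noteq> {}" by blast
      moreover have "finite T" "T \<subseteq> A \<times> UNIV" using F0 by (auto simp: T_def)
      ultimately obtain G u' where G: "finite G" "G \<subseteq> A" "u' \<in> rational_box T"
        "\<And>w. w \<in> Y \<Longrightarrow> (\<forall>i\<in>G. ev w i = ev u' i) \<Longrightarrow> w \<in> U"
        using spec[OF refl, of T] by blast
      have "u' \<in> weak_ball y F0 d0"
        unfolding weak_ball_def
      proof (intro CollectI conjI ballI)
        show "u' \<in> Y" using G(3) by (simp add: rational_box_def)
        fix i assume i: "i \<in> F0"
        then have "of_rat (a i) < ev u' i \<and> ev u' i < of_rat (b i)"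
          using G(3) by (simp add: rational_box_def T_def)
        with ab[OF i] show "\<bar>ev u' i - ev y i\<bar> < d0" by (simp add: abs_less_iff)
      qed
      then obtain w where "w \<in> weak_ball y F d" "\<forall>i\<in>G. ev w i = ev u' i"
        using amalg G(1,2) by meson
      then have "w \<in> weak_ball y F d \<inter> U"
        using G(4)[of w] by (auto simp: weak_ball_def)
      with F(4) show False by blast
    qed
    with F0 show ?thesis by blast
  qed
  show ?thesis
  proof (rule exI[of _ A], intro conjI A ballI impI, elim exE conjE)
    fix y F d assume "y \<in> Y" "finite F" "F \<subseteq> I" "0 < d" "weak_ball y F d \<inter> U = {}"
    then show "\<exists>F d. finite F \<and> F \<subseteq> A \<and> 0 < d \<and> weak_ball y F d \<inter> U = {}"
      by (rule sep)
  qed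
qed

lemma weakly_open_vimage_less:
  assumes f: "weakly_continuous I f"
  shows "weakly_open {u \<in> Y. f u < r}"
  unfolding weakly_open_def
proof (intro conjI ballI)
  fix y assume y: "y \<in> {u \<in> Y. f u < r}"
  then have "y \<in> Y" "0 < r - f y" by auto
  then obtain F d where F: "finite F" "F \<subseteq> I" "0 < d" "\<forall>u \<in> weak_ball y F d. \<bar>f u - f y\<bar> < r - f y"
    by (rule weakly_continuousE[OF f])
  have "weak_ball y F d \<subseteq> {u \<in> Y. f u < r}"
  proof
    fix u assume u: "u \<in> weak_ball y F d"
    with F(4) have "\<bar>f u - f y\<bar> < r - f y" by (rule bspec)
    with u show "u \<in> {u \<in> Y. f u < r}" by (auto simp: weak_ball_def)
  qed
  with F show "\<exists>F d. finite F \<and> F \<subseteq> I \<and> 0 < d \<and> weak_ball y F d \<subseteq> {u \<in> Y. f u < r}" by blast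
qed auto

text \<open>If the rational \<open>r\<close> is below \<open>f y\<close>, continuity keeps
  \<open>y\<close> out of the closure of the open set \<open>f < r\<close>, so coordinates from a
  countable set depending on \<open>r\<close> alone already give \<open>f \<ge> r\<close> near
  \<open>y\<close>. The union of these sets over all \<open>r\<close> is countable.\<close>

lemma countable_lower_semicontinuity:
  assumes f: "weakly_continuous I f"
  shows "\<exists>A. countable A \<and> A \<subseteq> I \<and> (\<forall>y\<in>Y. \<forall>e>0. \<exists>F d. finite F \<and> F \<subseteq> A \<and> 0 < d \<and>
     (\<forall>u \<in> weak_ball y F d. f y - e < f u))"
proof -
  have "\<forall>r::rat. \<exists>A. countable A \<and> A \<subseteq> I \<and>
    (\<forall>y\<in>Y. (\<exists>F d. finite F \<and> F \<subseteq> I \<and> 0 < d \<and> weak_ball y F d \<inter> {u \<in> Y. f u < of_rat r} = {}) \<longrightarrow>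
       (\<exists>F d. finite F \<and> F \<subseteq> A \<and> 0 < d \<and> weak_ball y F d \<inter> {u \<in> Y. f u < of_rat r} = {}))"
    by (intro allI closure_determined_by_countable weakly_open_vimage_less f)
  from choice[OF this] obtain A where AA: "\<forall>r::rat. countable (A r) \<and> A r \<subseteq> I \<and>
    (\<forall>y\<in>Y. (\<exists>F d. finite F \<and> F \<subseteq> I \<and> 0 < d \<and> weak_ball y F d \<inter> {u \<in> Y. f u < of_rat r} = {}) \<longrightarrow>
       (\<exists>F d. finite F \<and> F \<subseteq> A r \<and> 0 < d \<and> weak_ball y F d \<inter> {u \<in> Y. f u < of_rat r} = {}))" ..
  have A: "countable (A r)" "A r \<subseteq> I" for r
    using spec[OF AA, of r] by simp_all
  have sep: "\<exists>F d. finite F \<and> F \<subseteq> A r \<and> 0 < d \<and> weak_ball y F d \<inter> {u \<in> Y. f u < of_rat r} = {}"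
    if "y \<in> Y" "finite F" "F \<subseteq> I" "0 < d" "weak_ball y F d \<inter> {u \<in> Y. f u < of_rat r} = {}" for r y F d
    by (rule spec[OF AA, of r, THEN conjunct2, THEN conjunct2, THEN bspec, OF that(1), THEN mp])
      (rule exI[of _ F], rule exI[of _ d], intro conjI that(2-))
  show ?thesis
  proof (rule exI[of _ "\<Union>r. A r"], intro conjI ballI allI impI)
    fix y and e :: real assume y: "y \<in> Y" and e: "0 < e"
    obtain r where r: "f y - e < of_rat r" "of_rat r < f y"
      using of_rat_dense[of "f y - e" "f y"] e by auto
    have "0 < f y - of_rat r" using r(2) by simp
    then obtain F d where F: "finite F" "F \<subseteq> I" "0 < d"
      and close: "\<forall>u \<in> weak_ball y F d. \<bar>f u - f y\<bar> < f y - of_rat r"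
      by (rule weakly_continuousE[OF f y])
    have "weak_ball y F d \<inter> {u \<in> Y. f u < of_rat r} = {}"
      using close by force
    from sep[OF y F this] obtain G c where G: "finite G" "G \<subseteq> A r" "0 < c"
      "weak_ball y G c \<inter> {u \<in> Y. f u < of_rat r} = {}" by (elim exE conjE)
    have "f y - e < f u" if "u \<in> weak_ball y G c" for u
    proof -
      have "u \<in> Y" using that by (simp add: weak_ball_def)
      then have "\<not> f u < of_rat r" using G(4) that by blast
      then show ?thesis using r(1) by simp
    qed
    moreover have "G \<subseteq> (\<Union>r. A r)" using G(2) by (rule order_trans) auto
    ultimately show "\<exists>F d. finite F \<and> F \<subseteq> (\<Union>r. A r) \<and> 0 < d \<and> (\<forall>u \<in> weak_ball y F d. f y - e < f u)"
      using G(1,3) by (intro exI[of _ G] exI[of _ c] conjI ballI)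
  qed (simp_all add: A UN_least)
qed

text \<open>The missing half of continuity is lower semicontinuity of \<open>- f\<close>.\<close>

lemma weakly_continuous_countable_support:
  assumes f: "weakly_continuous I f"
  shows "\<exists>A. countable A \<and> A \<subseteq> I \<and> weakly_continuous A f"
proof -
  obtain A where A: "countable A" "A \<subseteq> I"
    and low: "\<forall>y\<in>Y. \<forall>e>0. \<exists>F d. finite F \<and> F \<subseteq> A \<and> 0 < d \<and> (\<forall>u \<in> weak_ball y F d. f y - e < f u)"
    using countable_lower_semicontinuity[OF f] by (elim exE conjE) (rule that)
  obtain B where B: "countable B" "B \<subseteq> I"
    and upp: "\<forall>y\<in>Y. \<forall>e>0. \<exists>F d. finite F \<and> F \<subseteq> B \<and> 0 < d \<and> (\<forall>u \<in> weak_ball y F d. - f y - e < - f u)"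
    using countable_lower_semicontinuity[OF weakly_continuous_uminus[OF f]] by (elim exE conjE) (rule that)
  have "weakly_continuous (A \<union> B) f"
    unfolding weakly_continuous_def
  proof (intro ballI allI impI)
    fix y and e :: real assume y: "y \<in> Y" and e: "0 < e"
    obtain F d where F: "finite F" "F \<subseteq> A" "0 < d" "\<forall>u \<in> weak_ball y F d. f y - e < f u"
      using low[THEN bspec, OF y, THEN spec, of e, THEN mp, OF e] by (elim exE conjE) (rule that)
    obtain G d' where G: "finite G" "G \<subseteq> B" "0 < d'" "\<forall>u \<in> weak_ball y G d'. - f y - e < - f u"
      using upp[THEN bspec, OF y, THEN spec, of e, THEN mp, OF e] by (elim exE conjE) (rule that)
    have "\<bar>f u - f y\<bar> < e" if "u \<in> weak_ball y (F \<union> G) (min d d')" for u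
    proof -
      have "u \<in> weak_ball y F d" "u \<in> weak_ball y G d'" using that by (auto simp: weak_ball_def)
      from bspec[OF F(4) this(1)] bspec[OF G(4) this(2)] show ?thesis by (simp add: abs_less_iff)
    qed
    then show "\<exists>F d. finite F \<and> F \<subseteq> A \<union> B \<and> 0 < d \<and> (\<forall>u \<in> weak_ball y F d. \<bar>f u - f y\<bar> < e)"
      using F G by (intro exI[of _ "F \<union> G"] exI[of _ "min d d'"]) auto
  qed
  with A B show ?thesis by (intro exI[of _ "A \<union> B"]) auto
qed

end

section \<open>Jordan decomposition of signed Borel measures\<close>

lemma sigma_algebra_borel_sets: "sigma_algebra (topspace K) (borel_sets K)"
  unfolding borel_sets_def
  by (rule sigma_algebra_sigma_sets) (auto dest: openin_subset)

lemma borel_sets_subset: "A \<in> borel_sets K \<Longrightarrow> A \<subseteq> topspace K"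
  unfolding borel_sets_def using sigma_sets_into_sp[of "{U. openin K U}" "topspace K" A]
  by (auto dest: openin_subset)

lemma borel_sets_Int: "A \<in> borel_sets K \<Longrightarrow> B \<in> borel_sets K \<Longrightarrow> A \<inter> B \<in> borel_sets K"
  and borel_sets_Un: "A \<in> borel_sets K \<Longrightarrow> B \<in> borel_sets K \<Longrightarrow> A \<union> B \<in> borel_sets K"
  and borel_sets_Diff: "A \<in> borel_sets K \<Longrightarrow> B \<in> borel_sets K \<Longrightarrow> A - B \<in> borel_sets K"
  and borel_sets_empty [simp]: "{} \<in> borel_sets K"
  and borel_sets_topspace [simp]: "topspace K \<in> borel_sets K"
  and borel_sets_UN: "range C \<subseteq> borel_sets K \<Longrightarrow> (\<Union>n::nat. C n) \<in> borel_sets K"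
proof -
  interpret sigma_algebra "topspace K" "borel_sets K" by (rule sigma_algebra_borel_sets)
  show "A \<in> borel_sets K \<Longrightarrow> B \<in> borel_sets K \<Longrightarrow> A \<inter> B \<in> borel_sets K"
    and "A \<in> borel_sets K \<Longrightarrow> B \<in> borel_sets K \<Longrightarrow> A \<union> B \<in> borel_sets K"
    and "A \<in> borel_sets K \<Longrightarrow> B \<in> borel_sets K \<Longrightarrow> A - B \<in> borel_sets K"
    and "{} \<in> borel_sets K" and "topspace K \<in> borel_sets K"
    and "range C \<subseteq> borel_sets K \<Longrightarrow> (\<Union>n::nat. C n) \<in> borel_sets K"
    by auto
qed

lemma borel_sets_openin: "openin K U \<Longrightarrow> U \<in> borel_sets K"
  unfolding borel_sets_def by (auto intro: sigma_sets.Basic)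

lemma borel_sets_closedin: "closedin K C \<Longrightarrow> C \<in> borel_sets K"
  using borel_sets_Diff[OF borel_sets_topspace borel_sets_openin[of K "topspace K - C"]]
  by (auto simp: closedin_def double_diff)

lemma borel_sets_countable_Union:
  "countable \<A> \<Longrightarrow> \<A> \<subseteq> borel_sets K \<Longrightarrow> \<Union>\<A> \<in> borel_sets K"
  using sigma_algebra.countable_Union[OF sigma_algebra_borel_sets] by blast

lemma signed_borel_empty: "signed_borel_measure K \<mu> \<Longrightarrow> \<mu> {} = 0"
proof -
  assume "signed_borel_measure K \<mu>"
  then have "\<forall>A :: nat \<Rightarrow> 'a set. range A \<subseteq> borel_sets K \<and> disjoint_family A
         \<longrightarrow> (\<lambda>n. \<mu> (A n)) sums \<mu> (\<Union>n. A n)"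
    by (auto simp: signed_borel_measure_def)
  from spec[OF this, of "\<lambda>_. {}"] have "(\<lambda>n::nat. \<mu> {}) sums \<mu> {}"
    by (simp add: disjoint_family_on_def image_subset_iff)
  then show ?thesis
    using sums_summable summable_const_iff by blast
qed

lemma signed_borel_sums:
  "signed_borel_measure K \<mu> \<Longrightarrow> range A \<subseteq> borel_sets K \<Longrightarrow> disjoint_family A
    \<Longrightarrow> (\<lambda>n. \<mu> (A n)) sums \<mu> (\<Union>n::nat. A n)"
  by (auto simp: signed_borel_measure_def)

lemma signed_borel_Un:
  assumes \<mu>: "signed_borel_measure K \<mu>" and A: "A \<in> borel_sets K" "B \<in> borel_sets K" "A \<inter> B = {}"
  shows "\<mu> (A \<union> B) = \<mu> A + \<mu> B"
proof -
  have "(\<lambda>n. \<mu> (binaryset A B n)) sums \<mu> (\<Union>n. binaryset A B n)"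
    using A by (intro signed_borel_sums[OF \<mu>])
      (auto simp: binaryset_def disjoint_family_on_def)
  moreover have "(\<lambda>n. \<mu> (binaryset A B n)) sums (\<mu> A + \<mu> B)"
    by (rule binaryset_sums) (rule signed_borel_empty[OF \<mu>])
  ultimately show ?thesis
    by (simp add: UN_binaryset_eq sums_unique2)
qed

lemma signed_borel_Diff:
  assumes \<mu>: "signed_borel_measure K \<mu>" and A: "A \<in> borel_sets K" "B \<in> borel_sets K" "B \<subseteq> A"
  shows "\<mu> (A - B) = \<mu> A - \<mu> B"
proof -
  have "B \<union> (A - B) = A" using A by auto
  then show ?thesis
    using signed_borel_Un[OF \<mu> A(2) borel_sets_Diff[OF A(1,2)]] by auto
qed

lemma signed_borel_lincomb:
  assumes "signed_borel_measure K \<mu>" "signed_borel_measure K \<nu>"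
  shows "signed_borel_measure K (\<lambda>A. a * \<mu> A + b * \<nu> A)"
  using assms by (auto simp: signed_borel_measure_def intro!: sums_add sums_mult)

lemma signed_borel_uminus:
  assumes "signed_borel_measure K \<mu>"
  shows "signed_borel_measure K (\<lambda>A. - \<mu> A)"
  using signed_borel_lincomb[OF assms assms, of "-1" 0] by simp

lemma sets_pos_variation [simp]: "sets (pos_variation K \<mu>) = borel_sets K"
  and space_pos_variation [simp]: "space (pos_variation K \<mu>) = topspace K"
  unfolding pos_variation_def
  by (rule sigma_algebra.sets_measure_of_eq[OF sigma_algebra_borel_sets]
      sigma_algebra.space_measure_of_eq[OF sigma_algebra_borel_sets])+

text \<open>Truncation at \<open>0\<close> by \<open>ennreal\<close> is subadditive, so truncating
  term by term can only enlarge the partial sums.\<close>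

lemma ennreal_sums_le:
  assumes "a sums s"
  shows "ennreal s \<le> (\<Sum>i. ennreal (a i))"
proof -
  have "(\<lambda>n. ennreal (\<Sum>i<n. a i)) \<longlonglongrightarrow> ennreal s"
    using assms unfolding sums_def by (rule tendsto_ennrealI)
  moreover have "ennreal (\<Sum>i<n. a i) \<le> (\<Sum>i. ennreal (a i))" for n
  proof -
    have "ennreal (\<Sum>i<n. a i) \<le> (\<Sum>i<n. ennreal (a i))"
    proof (induction n)
      case (Suc n)
      have "ennreal ((\<Sum>i<n. a i) + a n) \<le> ennreal (\<Sum>i<n. a i) + ennreal (a n)"
        by (cases "0 \<le> (\<Sum>i<n. a i)"; cases "0 \<le> a n")
          (auto simp: ennreal_neg ennreal_plus[symmetric] simp del: ennreal_plus intro!: ennreal_leI)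
      also have "\<dots> \<le> (\<Sum>i<n. ennreal (a i)) + ennreal (a n)"
        using Suc by (simp add: add_right_mono)
      finally show ?case by simp
    qed simp
    also have "\<dots> \<le> (\<Sum>i. ennreal (a i))"
      by (rule sum_le_suminf) auto
    finally show ?thesis .
  qed
  ultimately show ?thesis
    by (intro LIMSEQ_le_const2[of _ "ennreal s"]) auto
qed

text \<open>The set function inside \<open>pos_variation\<close>, named separately because
  \<open>measure_of\<close> returns it as \<open>emeasure\<close> only once countable additivity is
  known.\<close>

definition upper_sup :: "'b topology \<Rightarrow> ('b set \<Rightarrow> real) \<Rightarrow> 'b set \<Rightarrow> ennreal" where
  "upper_sup K \<mu> A = (SUP B \<in> {B \<in> borel_sets K. B \<subseteq> A}. ennreal (\<mu> B))"

lemma upper_sup_upper: "B \<in> borel_sets K \<Longrightarrow> B \<subseteq> A \<Longrightarrow> ennreal (\<mu> B) \<le> upper_sup K \<mu> A"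
  unfolding upper_sup_def by (rule SUP_upper) auto

lemma upper_sup_mono: "A \<subseteq> B \<Longrightarrow> upper_sup K \<mu> A \<le> upper_sup K \<mu> B"
  unfolding upper_sup_def by (rule SUP_subset_mono) auto

lemma upper_sup_superadditive:
  assumes \<mu>: "signed_borel_measure K \<mu>" and disj: "A \<inter> B = {}"
  shows "upper_sup K \<mu> A + upper_sup K \<mu> B \<le> upper_sup K \<mu> (A \<union> B)"
proof -
  have *: "ennreal (\<mu> C) + ennreal (\<mu> D) \<le> upper_sup K \<mu> (A \<union> B)"
    if CD: "C \<in> borel_sets K" "C \<subseteq> A" "D \<in> borel_sets K" "D \<subseteq> B" for C D
  proof -
    \<comment> \<open>\<open>ennreal\<close> is additive only on nonnegative values, so a set of
      negative measure is replaced by \<open>{}\<close>, which changes nothing after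
      truncation.\<close>
    define C' where "C' = (if \<mu> C < 0 then {} else C)"
    define D' where "D' = (if \<mu> D < 0 then {} else D)"
    have C': "C' \<in> borel_sets K" "C' \<subseteq> A" "ennreal (\<mu> C) = ennreal (\<mu> C')" "0 \<le> \<mu> C'"
      using CD signed_borel_empty[OF \<mu>] by (auto simp: C'_def ennreal_neg)
    have D': "D' \<in> borel_sets K" "D' \<subseteq> B" "ennreal (\<mu> D) = ennreal (\<mu> D')" "0 \<le> \<mu> D'"
      using CD signed_borel_empty[OF \<mu>] by (auto simp: D'_def ennreal_neg)
    have "C' \<inter> D' = {}" using C' D' disj by auto
    then have "ennreal (\<mu> C) + ennreal (\<mu> D) = ennreal (\<mu> (C' \<union> D'))"
      using C' D' signed_borel_Un[OF \<mu> C'(1) D'(1)] by simp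
    also have "\<dots> \<le> upper_sup K \<mu> (A \<union> B)"
      using C' D' by (intro upper_sup_upper borel_sets_Un) auto
    finally show ?thesis .
  qed
  have ne: "{D \<in> borel_sets K. D \<subseteq> B} \<noteq> {}" "{C \<in> borel_sets K. C \<subseteq> A} \<noteq> {}"
    by (auto intro: exI[of _ "{}"])
  have "(SUP D \<in> {D \<in> borel_sets K. D \<subseteq> B}. ennreal (\<mu> C) + ennreal (\<mu> D)) \<le> upper_sup K \<mu> (A \<union> B)"
    if "C \<in> borel_sets K" "C \<subseteq> A" for C
    by (auto intro!: SUP_least * that)
  then have "(SUP C \<in> {C \<in> borel_sets K. C \<subseteq> A}. ennreal (\<mu> C) + upper_sup K \<mu> B) \<le> upper_sup K \<mu> (A \<union> B)"
    by (intro SUP_least) (simp add: ennreal_SUP_add_right[OF ne(1)] upper_sup_def[of K \<mu> B])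
  then show ?thesis
    unfolding ennreal_SUP_add_left[OF ne(2)] upper_sup_def[of K \<mu> A, symmetric] .
qed

text \<open>Superadditivity on finite unions gives one inequality; for the other, a Borel
  \<open>B\<close> inside the union is cut along the \<open>A i\<close>.\<close>

lemma countably_additive_upper_sup:
  assumes \<mu>: "signed_borel_measure K \<mu>"
  shows "countably_additive (borel_sets K) (upper_sup K \<mu>)"
  unfolding countably_additive_def
proof (intro allI impI antisym)
  fix A :: "nat \<Rightarrow> 'a set"
  assume A: "range A \<subseteq> borel_sets K" and disj: "disjoint_family A" and U: "\<Union> (range A) \<in> borel_sets K"
  have "(\<Sum>i<n. upper_sup K \<mu> (A i)) \<le> upper_sup K \<mu> (\<Union>i<n. A i)" for n
  proof (induction n)
    case (Suc n)
    have "(\<Union>i<n. A i) \<inter> A n = {}"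
      using disj by (auto simp: disjoint_family_on_def) (metis IntI empty_iff less_irrefl)
    then have "upper_sup K \<mu> (\<Union>i<n. A i) + upper_sup K \<mu> (A n) \<le> upper_sup K \<mu> ((\<Union>i<n. A i) \<union> A n)"
      by (rule upper_sup_superadditive[OF \<mu>])
    with Suc show ?case
      by (simp add: lessThan_Suc Un_commute[of "A n"] add.commute[of "upper_sup K \<mu> (A n)"])
        (rule order_trans[OF add_right_mono])
  qed simp
  then have "(\<Sum>i<n. upper_sup K \<mu> (A i)) \<le> upper_sup K \<mu> (\<Union>i. A i)" for n
    by (rule order_trans) (rule upper_sup_mono, auto)
  then show "(\<Sum>i. upper_sup K \<mu> (A i)) \<le> upper_sup K \<mu> (\<Union>i. A i)"
    by (intro suminf_le_const) auto
  show "upper_sup K \<mu> (\<Union>i. A i) \<le> (\<Sum>i. upper_sup K \<mu> (A i))"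
    unfolding upper_sup_def[of K \<mu> "\<Union>i. A i"]
  proof (rule SUP_least, clarify)
    fix B assume B: "B \<in> borel_sets K" "B \<subseteq> (\<Union>i. A i)"
    have "(\<lambda>i. \<mu> (B \<inter> A i)) sums \<mu> (\<Union>i. B \<inter> A i)"
      using A B disjoint_family_subset[OF disj, of "\<lambda>i. B \<inter> A i"]
      by (intro signed_borel_sums[OF \<mu>]) (auto intro!: borel_sets_Int)
    also have "(\<Union>i. B \<inter> A i) = B" using B by auto
    finally have "ennreal (\<mu> B) \<le> (\<Sum>i. ennreal (\<mu> (B \<inter> A i)))"
      by (rule ennreal_sums_le)
    also have "\<dots> \<le> (\<Sum>i. upper_sup K \<mu> (A i))"
      using A B by (intro suminf_le upper_sup_upper borel_sets_Int) auto
    finally show "ennreal (\<mu> B) \<le> (\<Sum>i. upper_sup K \<mu> (A i))" .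
  qed
qed

lemma emeasure_pos_variation:
  assumes \<mu>: "signed_borel_measure K \<mu>" and A: "A \<in> borel_sets K"
  shows "emeasure (pos_variation K \<mu>) A = upper_sup K \<mu> A"
proof -
  have "pos_variation K \<mu> = measure_of (topspace K) (borel_sets K) (upper_sup K \<mu>)"
    by (simp add: pos_variation_def upper_sup_def[abs_def])
  moreover have "positive (borel_sets K) (upper_sup K \<mu>)"
  proof -
    have "{B \<in> borel_sets K. B \<subseteq> {}} = {{}}" by auto
    then show ?thesis
      by (simp add: positive_def upper_sup_def signed_borel_empty[OF \<mu>])
  qed
  ultimately show ?thesis
    using sigma_algebra_borel_sets[of K] A countably_additive_upper_sup[OF \<mu>]
    by (metis sets_pos_variation emeasure_measure_of_sigma)
qed

lemma upper_sup_Un: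
  assumes \<mu>: "signed_borel_measure K \<mu>" and A: "A \<in> borel_sets K" "B \<in> borel_sets K" "A \<inter> B = {}"
  shows "upper_sup K \<mu> (A \<union> B) = upper_sup K \<mu> A + upper_sup K \<mu> B"
  using plus_emeasure[of A "pos_variation K \<mu>" B] A
  unfolding sets_pos_variation
  by (simp only: emeasure_pos_variation[OF \<mu>] borel_sets_Un simp_thms)

text \<open>
  A set of infinite variation splits into two pieces of measure at least \<open>1\<close> in absolute value, one of
  which has infinite variation again; iterating gives a divergent series.
\<close>

lemma upper_sup_finite:
  assumes \<mu>: "signed_borel_measure K \<mu>"
  shows "upper_sup K \<mu> (topspace K) + upper_sup K (\<lambda>A. - \<mu> A) (topspace K) < \<infinity>"
proof (rule ccontr)
  note \<mu>' = signed_borel_uminus[OF \<mu>]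
  define t where "t A = upper_sup K \<mu> A + upper_sup K (\<lambda>A. - \<mu> A) A" for A
  have t_Un: "t (A \<union> B) = t A + t B" if "A \<in> borel_sets K" "B \<in> borel_sets K" "A \<inter> B = {}" for A B
    unfolding t_def upper_sup_Un[OF \<mu> that] upper_sup_Un[OF \<mu>' that] by (simp only: ac_simps)
  have big: "\<exists>B \<in> borel_sets K. B \<subseteq> A \<and> 1 \<le> \<bar>\<mu> B\<bar> \<and> 1 \<le> \<bar>\<mu> (A - B)\<bar>"
    if A: "A \<in> borel_sets K" "t A = \<infinity>" for A
  proof -
    \<comment> \<open>\<open>A\<close> itself may have large measure; the surplus \<open>1\<close>
      over the absolute value of \<open>\<mu> A\<close> makes both \<open>B\<close> and
      \<open>A - B\<close> large.\<close>
    have "\<exists>B \<in> borel_sets K. B \<subseteq> A \<and> \<bar>\<mu> A\<bar> + 1 < \<bar>\<mu> B\<bar>"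
    proof (rule ccontr)
      assume "\<not> ?thesis"
      then have *: "\<bar>\<mu> B\<bar> \<le> \<bar>\<mu> A\<bar> + 1" if "B \<in> borel_sets K" "B \<subseteq> A" for B
        using that by force
      have "upper_sup K \<mu> A \<le> ennreal (\<bar>\<mu> A\<bar> + 1)" "upper_sup K (\<lambda>A. - \<mu> A) A \<le> ennreal (\<bar>\<mu> A\<bar> + 1)"
        unfolding upper_sup_def using *
        by (auto intro!: SUP_least ennreal_leI dest: abs_le_D1 abs_le_D2 simp del: ennreal_plus)
      then have "upper_sup K \<mu> A < \<infinity>" "upper_sup K (\<lambda>A. - \<mu> A) A < \<infinity>"
        by (auto simp: less_top[symmetric] top_unique)
      then show False using A(2) by (auto simp: t_def)
    qed
    then obtain B where B: "B \<in> borel_sets K" "B \<subseteq> A" "\<bar>\<mu> A\<bar> + 1 < \<bar>\<mu> B\<bar>" by auto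
    then show ?thesis
      using signed_borel_Diff[OF \<mu> A(1) B(1,2)] by (intro bexI[of _ B]) auto
  qed
  have step: "\<exists>B. (B \<in> borel_sets K \<and> t B = \<infinity>) \<and> B \<subseteq> A \<and> 1 \<le> \<bar>\<mu> (A - B)\<bar>"
    if A: "A \<in> borel_sets K \<and> t A = \<infinity>" for A and n :: nat
  proof -
    obtain B where B: "B \<in> borel_sets K" "B \<subseteq> A" "1 \<le> \<bar>\<mu> B\<bar>" "1 \<le> \<bar>\<mu> (A - B)\<bar>"
      using big A by blast
    have "t (B \<union> (A - B)) = t B + t (A - B)"
      using A B by (intro t_Un borel_sets_Diff) auto
    moreover have "B \<union> (A - B) = A" using B by auto
    ultimately have "t B = \<infinity> \<or> t (A - B) = \<infinity>"
      using A by (auto simp: eq_commute[of top])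
    moreover have "A - (A - B) = B" using B by auto
    moreover have "A - B \<in> borel_sets K" using A B borel_sets_Diff by blast
    ultimately show ?thesis using B
      by (metis Diff_subset)
  qed
  assume "\<not> ?thesis"
  then have "t (topspace K) = \<infinity>" by (simp add: t_def less_top[symmetric])
  then have "\<exists>B. (B \<in> borel_sets K \<and> t B = \<infinity>)"
    by (intro exI[of _ "topspace K"]) simp
  from dependent_nat_choice[where P = "\<lambda>_ B. B \<in> borel_sets K \<and> t B = \<infinity>"
      and Q = "\<lambda>_ A B. B \<subseteq> A \<and> 1 \<le> \<bar>\<mu> (A - B)\<bar>", OF this step]
  obtain E where E: "\<And>n::nat. E n \<in> borel_sets K" "\<And>n. E (Suc n) \<subseteq> E n" "\<And>n. 1 \<le> \<bar>\<mu> (E n - E (Suc n))\<bar>"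
    by blast
  \<comment> \<open>Complements turn the decreasing sequence into an increasing one, as
    \<open>disjoint_family_Suc\<close> expects.\<close>
  have "disjoint_family (\<lambda>n. (topspace K - E (Suc n)) - (topspace K - E n))"
    by (rule disjoint_family_Suc) (use E in auto)
  moreover have "(\<lambda>n. (topspace K - E (Suc n)) - (topspace K - E n)) = (\<lambda>n. E n - E (Suc n))"
    using E borel_sets_subset by fastforce
  ultimately have "(\<lambda>n. \<mu> (E n - E (Suc n))) sums \<mu> (\<Union>n. E n - E (Suc n))"
    using E by (intro signed_borel_sums[OF \<mu>]) (auto intro!: borel_sets_Diff)
  then have "(\<lambda>n. \<mu> (E n - E (Suc n))) \<longlonglongrightarrow> 0"
    using summable_LIMSEQ_zero sums_summable by blast
  then have "eventually (\<lambda>n. \<bar>\<mu> (E n - E (Suc n))\<bar> < 1) sequentially"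
    by (auto simp: tendsto_iff dist_real_def)
  then show False using E(3) by (auto simp: eventually_sequentially not_less[symmetric])
qed

lemma finite_measure_pos_variation:
  assumes \<mu>: "signed_borel_measure K \<mu>"
  shows "finite_measure (pos_variation K \<mu>)"
proof
  have "upper_sup K \<mu> (topspace K) < \<infinity>"
    using upper_sup_finite[OF \<mu>] by simp
  then show "emeasure (pos_variation K \<mu>) (space (pos_variation K \<mu>)) \<noteq> \<infinity>"
    by (simp add: emeasure_pos_variation[OF \<mu>])
qed

text \<open>Real values are meaningful because the variation is finite. \<open>measure\<close> is
  \<open>0\<close> off the Borel sets, in line with the normalisation in
  \<open>signed_borel_measure\<close>.\<close>

definition pos_part :: "'b topology \<Rightarrow> ('b set \<Rightarrow> real) \<Rightarrow> 'b set \<Rightarrow> real" where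
  "pos_part K \<mu> A = measure (pos_variation K \<mu>) A"

definition neg_part :: "'b topology \<Rightarrow> ('b set \<Rightarrow> real) \<Rightarrow> 'b set \<Rightarrow> real" where
  "neg_part K \<mu> = pos_part K (\<lambda>A. - \<mu> A)"

lemma pos_part_upper:
  assumes \<mu>: "signed_borel_measure K \<mu>" and A: "A \<in> borel_sets K" "B \<in> borel_sets K" "B \<subseteq> A"
  shows "\<mu> B \<le> pos_part K \<mu> A"
proof -
  have "ennreal (\<mu> B) \<le> emeasure (pos_variation K \<mu>) A"
    using A by (simp add: emeasure_pos_variation[OF \<mu>] upper_sup_upper)
  also have "\<dots> = ennreal (pos_part K \<mu> A)"
    using finite_measure.emeasure_eq_measure[OF finite_measure_pos_variation[OF \<mu>]] by (simp add: pos_part_def)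
  finally show ?thesis
    by (subst (asm) ennreal_le_iff) (auto simp: pos_part_def)
qed

lemma pos_part_least:
  assumes \<mu>: "signed_borel_measure K \<mu>" and A: "A \<in> borel_sets K"
    and c: "\<And>B. B \<in> borel_sets K \<Longrightarrow> B \<subseteq> A \<Longrightarrow> \<mu> B \<le> c"
  shows "pos_part K \<mu> A \<le> c"
proof -
  have "0 \<le> c" using c[of "{}"] signed_borel_empty[OF \<mu>] by simp
  have "emeasure (pos_variation K \<mu>) A \<le> ennreal c"
    using c A unfolding emeasure_pos_variation[OF \<mu> A] upper_sup_def
    by (auto intro!: SUP_least ennreal_leI)
  then show ?thesis
    using finite_measure.emeasure_eq_measure[OF finite_measure_pos_variation[OF \<mu>]] \<open>0 \<le> c\<close>
    by (simp add: pos_part_def)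
qed

lemma pos_part_nonneg: "0 \<le> pos_part K \<mu> A" and neg_part_nonneg: "0 \<le> neg_part K \<mu> A"
  by (auto simp: pos_part_def neg_part_def)

text \<open>For Borel \<open>B\<close> inside \<open>A\<close>,
  \<open>\<mu> B = \<mu> A - \<mu> (A - B)\<close>; taking suprema over \<open>B\<close> gives both
  inequalities, without a Hahn set.\<close>

lemma jordan_decomposition:
  assumes \<mu>: "signed_borel_measure K \<mu>"
  shows "\<mu> A = pos_part K \<mu> A - neg_part K \<mu> A"
proof (cases "A \<in> borel_sets K")
  case A: True
  note \<mu>' = signed_borel_uminus[OF \<mu>]
  have "pos_part K \<mu> A \<le> \<mu> A + neg_part K \<mu> A"
  proof (rule pos_part_least[OF \<mu> A])
    fix B assume B: "B \<in> borel_sets K" "B \<subseteq> A"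
    then show "\<mu> B \<le> \<mu> A + neg_part K \<mu> A"
      using pos_part_upper[OF \<mu>' A borel_sets_Diff[OF A B(1)]] signed_borel_Diff[OF \<mu> A B]
      by (auto simp: neg_part_def)
  qed
  moreover have "neg_part K \<mu> A \<le> pos_part K \<mu> A - \<mu> A"
    unfolding neg_part_def
  proof (rule pos_part_least[OF \<mu>' A])
    fix B assume B: "B \<in> borel_sets K" "B \<subseteq> A"
    then show "- \<mu> B \<le> pos_part K \<mu> A - \<mu> A"
      using pos_part_upper[OF \<mu> A borel_sets_Diff[OF A B(1)]] signed_borel_Diff[OF \<mu> A B]
      by auto
  qed
  ultimately show ?thesis by simp
next
  case False
  then show ?thesis
    using \<mu> by (simp add: pos_part_def neg_part_def measure_notin_sets signed_borel_measure_def)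
qed

lemma signed_borel_pos_part:
  assumes \<mu>: "signed_borel_measure K \<mu>"
  shows "signed_borel_measure K (pos_part K \<mu>)"
  unfolding signed_borel_measure_def pos_part_def
  using finite_measure.finite_measure_UNION[OF finite_measure_pos_variation[OF \<mu>]]
  by (auto simp: measure_notin_sets)

lemma signed_borel_neg_part:
  assumes \<mu>: "signed_borel_measure K \<mu>"
  shows "signed_borel_measure K (neg_part K \<mu>)"
  unfolding neg_part_def by (intro signed_borel_pos_part signed_borel_uminus \<mu>)

definition abs_part :: "'b topology \<Rightarrow> ('b set \<Rightarrow> real) \<Rightarrow> 'b set \<Rightarrow> real" where
  "abs_part K \<mu> A = pos_part K \<mu> A + neg_part K \<mu> A"

lemma total_variation_eq:
  assumes \<mu>: "signed_borel_measure K \<mu>"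
  shows "total_variation K \<mu> A = ennreal (abs_part K \<mu> A)"
  using finite_measure.emeasure_eq_measure[OF finite_measure_pos_variation[OF \<mu>]]
    finite_measure.emeasure_eq_measure[OF finite_measure_pos_variation[OF signed_borel_uminus[OF \<mu>]]]
  by (simp add: total_variation_def neg_variation_def abs_part_def pos_part_def neg_part_def)

lemma abs_part_nonneg: "0 \<le> abs_part K \<mu> A"
  by (simp add: abs_part_def pos_part_nonneg neg_part_nonneg)

lemma abs_part_mono:
  assumes \<mu>: "signed_borel_measure K \<mu>" and "B \<subseteq> A" "A \<in> borel_sets K" "B \<in> borel_sets K"
  shows "abs_part K \<mu> B \<le> abs_part K \<mu> A"
  using assms finite_measure.finite_measure_mono[OF finite_measure_pos_variation[OF \<mu>], of B A]
    finite_measure.finite_measure_mono[OF finite_measure_pos_variation[OF signed_borel_uminus[OF \<mu>]], of B A]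
  by (simp add: abs_part_def pos_part_def neg_part_def)

lemma abs_le_abs_part:
  assumes \<mu>: "signed_borel_measure K \<mu>"
  shows "\<bar>\<mu> A\<bar> \<le> abs_part K \<mu> A"
  using jordan_decomposition[OF \<mu>, of A] pos_part_nonneg[of K \<mu> A] neg_part_nonneg[of K \<mu> A]
  by (simp add: abs_part_def)

text \<open>The positive and the negative part of \<open>\<nu>\<close> are suprema of values bounded
  by \<open>C\<close> times the sum of the variations, whence the factor \<open>2\<close>. Two
  dominating measures allow linear combinations; the bound later carries regularity and null sets
  over to \<open>\<nu>\<close>.\<close>

lemma abs_part_dominated:
  assumes \<mu>: "signed_borel_measure K \<mu>" and \<mu>': "signed_borel_measure K \<mu>'" and \<nu>: "signed_borel_measure K \<nu>"
    and dom: "\<And>B. B \<in> borel_sets K \<Longrightarrow> \<bar>\<nu> B\<bar> \<le> C * (abs_part K \<mu> B + abs_part K \<mu>' B)"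
    and "0 \<le> C" and A: "A \<in> borel_sets K"
  shows "abs_part K \<nu> A \<le> 2 * C * (abs_part K \<mu> A + abs_part K \<mu>' A)"
proof -
  have *: "\<bar>\<nu> B\<bar> \<le> C * (abs_part K \<mu> A + abs_part K \<mu>' A)" if "B \<in> borel_sets K" "B \<subseteq> A" for B
    using dom[OF that(1)] abs_part_mono[OF \<mu> that(2) A that(1)] abs_part_mono[OF \<mu>' that(2) A that(1)] \<open>0 \<le> C\<close>
    by (smt (verit) mult_left_mono)
  have "pos_part K \<nu> A \<le> C * (abs_part K \<mu> A + abs_part K \<mu>' A)"
    using * by (intro pos_part_least[OF \<nu> A]) (auto dest: abs_le_D1)
  moreover have "neg_part K \<nu> A \<le> C * (abs_part K \<mu> A + abs_part K \<mu>' A)"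
    unfolding neg_part_def
    using * by (intro pos_part_least[OF signed_borel_uminus[OF \<nu>] A]) (auto dest: abs_le_D2)
  ultimately show ?thesis by (simp add: abs_part_def)
qed

lemma nonneg_parts:
  assumes \<mu>: "signed_borel_measure K \<mu>" and nn: "\<And>A. A \<in> borel_sets K \<Longrightarrow> 0 \<le> \<mu> A"
    and A: "A \<in> borel_sets K"
  shows "abs_part K \<mu> A = \<mu> A"
proof -
  have "neg_part K \<mu> A \<le> 0"
    unfolding neg_part_def
    by (rule pos_part_least[OF signed_borel_uminus[OF \<mu>] A]) (simp add: nn)
  then show ?thesis
    using jordan_decomposition[OF \<mu>, of A] neg_part_nonneg[of K \<mu> A] by (simp add: abs_part_def)
qed

section \<open>Integration and regularity\<close>

lemma measurable_pos_variation:
  assumes f: "continuous_map K euclideanreal f"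
  shows "f \<in> borel_measurable (pos_variation K \<mu>)"
proof (rule borel_measurableI)
  fix S :: "real set" assume "open S"
  then have "openin K {x \<in> topspace K. f x \<in> S}"
    using f by (auto intro: openin_continuous_map_preimage)
  moreover have "f -` S \<inter> space (pos_variation K \<mu>) = {x \<in> topspace K. f x \<in> S}" by auto
  ultimately show "f -` S \<inter> space (pos_variation K \<mu>) \<in> sets (pos_variation K \<mu>)"
    by (simp add: borel_sets_openin)
qed

lemma integral_near_step_sum:
  fixes f :: "'a \<Rightarrow> real" and c :: "'k \<Rightarrow> real"
  assumes M: "finite_measure M" and f: "f \<in> borel_measurable M"
    and fin: "finite (k ` space M)" and k: "\<And>j. {x \<in> space M. k x = j} \<in> sets M"
    and near: "\<And>x. x \<in> space M \<Longrightarrow> \<bar>f x - c (k x)\<bar> \<le> e"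
  shows "\<bar>(LINT x|M. f x) - (\<Sum>j \<in> k ` space M. c j * measure M {x \<in> space M. k x = j})\<bar>
           \<le> e * measure M (space M)"
proof -
  interpret finite_measure M by (rule M)
  define J where "J = k ` space M"
  define g where "g x = (\<Sum>j\<in>J. c j * indicator {x \<in> space M. k x = j} x)" for x
  have g: "g x = c (k x)" if "x \<in> space M" for x
  proof -
    have "g x = (\<Sum>j\<in>J. if j = k x then c j else 0)"
      unfolding g_def using that by (intro sum.cong) (auto simp: indicator_def)
    also have "\<dots> = c (k x)" using fin that by (simp add: J_def)
    finally show ?thesis .
  qed
  have "integrable M g" "(LINT x|M. g x) = (\<Sum>j\<in>J. c j * measure M {x \<in> space M. k x = j})"
    unfolding g_def using k by (auto simp: emeasure_eq_measure Int_absorb2 intro!: integrable_real_indicator)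
  moreover have "integrable M f"
  proof (rule integrable_const_bound)
    have "\<bar>f x\<bar> \<le> e + (\<Sum>j\<in>J. \<bar>c j\<bar>)" if x: "x \<in> space M" for x
    proof -
      have "\<bar>c (k x)\<bar> \<le> (\<Sum>j\<in>J. \<bar>c j\<bar>)"
        using fin x by (intro member_le_sum) (auto simp: J_def)
      then show ?thesis using near[OF x] by linarith
    qed
    then show "AE x in M. norm (f x) \<le> e + (\<Sum>j\<in>J. \<bar>c j\<bar>)" by (intro AE_I2) simp
  qed (rule f)
  ultimately have diff: "(LINT x|M. f x) - (\<Sum>j\<in>J. c j * measure M {x \<in> space M. k x = j}) = (LINT x|M. f x - g x)"
    and int: "integrable M (\<lambda>x. f x - g x)"
    by simp_all
  have "\<bar>LINT x|M. f x - g x\<bar> \<le> (LINT x|M. \<bar>f x - g x\<bar>)"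
    by (rule integral_abs_bound)
  also have "\<dots> \<le> (LINT x|M. e)"
    by (rule integral_mono) (use int g near in auto)
  also have "\<dots> = e * measure M (space M)" by simp
  finally show ?thesis using diff by (simp add: J_def)
qed

text \<open>The variations of a sum of measures are not the sums of their variations, so linearity
  in \<open>\<mu>\<close> is not visible from the definition of \<open>signed_integral\<close>. The
  step sum is linear in \<open>\<mu>\<close>, and its error is at most \<open>e\<close> times the
  total variation.\<close>

lemma signed_integral_near_step_sum:
  assumes \<mu>: "signed_borel_measure K \<mu>" and f: "continuous_map K euclideanreal f"
    and fin: "finite (k ` topspace K)" and k: "\<And>j. {x \<in> topspace K. k x = j} \<in> borel_sets K"
    and near: "\<And>x. x \<in> topspace K \<Longrightarrow> \<bar>f x - c (k x)\<bar> \<le> e"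
  shows "\<bar>signed_integral K \<mu> f - (\<Sum>j \<in> k ` topspace K. c j * \<mu> {x \<in> topspace K. k x = j})\<bar>
           \<le> e * abs_part K \<mu> (topspace K)"
proof -
  note \<mu>' = signed_borel_uminus[OF \<mu>]
  have *: "\<bar>(LINT x|pos_variation K \<nu>. f x) - (\<Sum>j \<in> k ` topspace K. c j * pos_part K \<nu> {x \<in> topspace K. k x = j})\<bar>
      \<le> e * pos_part K \<nu> (topspace K)" if "signed_borel_measure K \<nu>" for \<nu>
    using integral_near_step_sum[OF finite_measure_pos_variation[OF that] measurable_pos_variation[OF f], where k=k and c=c and e=e]
      fin k near by (simp add: pos_part_def)
  have "(\<Sum>j \<in> k ` topspace K. c j * \<mu> {x \<in> topspace K. k x = j}) =
     (\<Sum>j \<in> k ` topspace K. c j * pos_part K \<mu> {x \<in> topspace K. k x = j}) -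
     (\<Sum>j \<in> k ` topspace K. c j * neg_part K \<mu> {x \<in> topspace K. k x = j})"
    by (subst jordan_decomposition[OF \<mu>]) (simp add: algebra_simps sum_subtractf)
  with *[OF \<mu>] *[OF \<mu>'] show ?thesis
    by (simp add: signed_integral_def neg_variation_def abs_part_def neg_part_def algebra_simps)
qed

lemma bounded_continuous_on_compact_space:
  assumes K: "compact_space K" and f: "continuous_map K euclideanreal f"
  obtains C where "0 \<le> C" "\<And>x. x \<in> topspace K \<Longrightarrow> \<bar>f x\<bar> \<le> C"
proof -
  have "compactin euclideanreal (f ` topspace K)"
    using image_compactin[OF _ f] K by (simp add: compact_space_def)
  then have "bounded (f ` topspace K)" by (simp add: compact_imp_bounded)
  then obtain C where "0 < C" "\<forall>x \<in> f ` topspace K. norm x \<le> C" by (auto simp: bounded_pos)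
  then show ?thesis by (intro that[of C]) auto
qed

text \<open>The label of \<open>x\<close> records the integer parts of \<open>f x / e\<close> for
  all \<open>f\<close> in \<open>F\<close>. Compactness bounds each \<open>f\<close>, so finitely
  many labels occur, and points with equal labels differ by less than \<open>e\<close> under every
  \<open>f\<close>; \<open>r\<close> picks one point per label.\<close>

lemma small_oscillation_partition:
  assumes K: "compact_space K" and F: "finite F" "\<And>f. f \<in> F \<Longrightarrow> continuous_map K euclideanreal f"
    and e: "0 < (e::real)"
  obtains k :: "'b \<Rightarrow> (('b \<Rightarrow> real) \<Rightarrow> int)" and r
  where "finite (k ` topspace K)" "\<And>j. {x \<in> topspace K. k x = j} \<in> borel_sets K"
    "\<And>x. x \<in> topspace K \<Longrightarrow> r (k x) \<in> topspace K"
    "\<And>f x. f \<in> F \<Longrightarrow> x \<in> topspace K \<Longrightarrow> \<bar>f x - f (r (k x))\<bar> \<le> e"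
proof
  define k where "k x = (\<lambda>f\<in>F. \<lfloor>f x / e\<rfloor>)" for x
  have "finite ((\<lambda>x. \<lfloor>f x / e\<rfloor>) ` topspace K)" if f: "f \<in> F" for f
  proof -
    obtain C where C: "0 \<le> C" "\<And>x. x \<in> topspace K \<Longrightarrow> \<bar>f x\<bar> \<le> C"
      using bounded_continuous_on_compact_space[OF K F(2)[OF f]] by metis
    have "- C / e \<le> f x / e \<and> f x / e \<le> C / e" if "x \<in> topspace K" for x
      using C(2)[OF that] e by (intro conjI divide_right_mono) (auto simp: abs_le_iff)
    then have "(\<lambda>x. \<lfloor>f x / e\<rfloor>) ` topspace K \<subseteq> {\<lfloor>- C / e\<rfloor>..\<lfloor>C / e\<rfloor>}"
      by (auto intro!: floor_mono simp del: divide_minus_left)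
    then show ?thesis by (rule finite_subset) simp
  qed
  then have "finite (PiE F (\<lambda>f. (\<lambda>x. \<lfloor>f x / e\<rfloor>) ` topspace K))"
    using F(1) by (intro finite_PiE)
  moreover have "k ` topspace K \<subseteq> PiE F (\<lambda>f. (\<lambda>x. \<lfloor>f x / e\<rfloor>) ` topspace K)"
    by (auto simp: k_def)
  ultimately show "finite (k ` topspace K)" by (rule finite_subset[rotated])
  show "{x \<in> topspace K. k x = j} \<in> borel_sets K" for j
  proof (cases "j \<in> extensional F")
    case True
    \<comment> \<open>The variation of the zero measure serves only as a measure space with the
      Borel sigma-algebra, which gives access to \<open>measurable\<close>.\<close>
    let ?M = "pos_variation K (\<lambda>_. 0)"
    have "{x \<in> topspace K. k x = j} = {x \<in> space ?M. \<forall>f\<in>F. \<lfloor>f x / e\<rfloor> = j f}"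
      using True by (auto simp: k_def fun_eq_iff extensional_def)
    also have "\<dots> \<in> sets ?M"
    proof (rule sets.sets_Collect_finite_All[OF _ F(1)])
      fix f assume "f \<in> F"
      then have [measurable]: "f \<in> borel_measurable ?M" by (intro measurable_pos_variation F(2))
      show "{x \<in> space ?M. \<lfloor>f x / e\<rfloor> = j f} \<in> sets ?M" by measurable
    qed
    finally show ?thesis by simp
  next
    case False
    then have *: "{x \<in> topspace K. k x = j} = {}" by (auto simp: k_def)
    show ?thesis unfolding * by (rule borel_sets_empty)
  qed
  define r where "r j = (SOME y. y \<in> topspace K \<and> k y = j)" for j
  have r: "r (k x) \<in> topspace K \<and> k (r (k x)) = k x" if "x \<in> topspace K" for x
    unfolding r_def by (rule someI[of _ x]) (simp add: that)
  then show "r (k x) \<in> topspace K" if "x \<in> topspace K" for x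
    using that by blast
  fix f x assume f: "f \<in> F" and x: "x \<in> topspace K"
  have "k (r (k x)) f = k x f" using r[OF x] by simp
  then have "\<lfloor>f x / e\<rfloor> = \<lfloor>f (r (k x)) / e\<rfloor>" using f by (simp add: k_def)
  then have "\<bar>f x / e - f (r (k x)) / e\<bar> < 1" by linarith
  then have "\<bar>f x - f (r (k x))\<bar> / e < 1" using e by (simp add: diff_divide_distrib[symmetric])
  then show "\<bar>f x - f (r (k x))\<bar> \<le> e" using e by simp
qed

lemma step_approximation:
  assumes K: "compact_space K" and f: "continuous_map K euclideanreal f" and e: "0 < (e::real)"
  obtains k :: "'b \<Rightarrow> (('b \<Rightarrow> real) \<Rightarrow> int)" and c
  where "finite (k ` topspace K)" "\<And>j. {x \<in> topspace K. k x = j} \<in> borel_sets K"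
    "\<And>x. x \<in> topspace K \<Longrightarrow> \<bar>f x - c (k x)\<bar> \<le> e"
proof -
  have F: "finite {f}" "\<And>g. g \<in> {f} \<Longrightarrow> continuous_map K euclideanreal g" using f by auto
  show thesis
  proof (rule small_oscillation_partition[OF K F e])
    fix k :: "'b \<Rightarrow> (('b \<Rightarrow> real) \<Rightarrow> int)" and r
    assume kr: "finite (k ` topspace K)" "\<And>j. {x \<in> topspace K. k x = j} \<in> borel_sets K"
      "\<And>g x. g \<in> {f} \<Longrightarrow> x \<in> topspace K \<Longrightarrow> \<bar>g x - g (r (k x))\<bar> \<le> e"
    have "\<bar>f x - f (r (k x))\<bar> \<le> e" if "x \<in> topspace K" for x
      using kr(3)[of f x] that by simp
    then show thesis using kr(1,2) that[of k "\<lambda>j. f (r j)"] by blast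
  qed
qed

text \<open>All three integrals are compared with step sums over one common partition; these are
  exactly linear in the measure, and the errors tend to \<open>0\<close> with
  \<open>e\<close>.\<close>

lemma signed_integral_lincomb:
  assumes K: "compact_space K" and \<mu>: "signed_borel_measure K \<mu>" and \<nu>: "signed_borel_measure K \<nu>"
    and f: "continuous_map K euclideanreal f"
  shows "signed_integral K (\<lambda>A. a * \<mu> A + b * \<nu> A) f = a * signed_integral K \<mu> f + b * signed_integral K \<nu> f"
proof -
  define \<sigma> where "\<sigma> A = a * \<mu> A + b * \<nu> A" for A
  have \<sigma>: "signed_borel_measure K \<sigma>"
    using signed_borel_lincomb[OF \<mu> \<nu>] by (simp add: \<sigma>_def[abs_def])
  define T where "T \<rho> = abs_part K \<rho> (topspace K)" for \<rho>
  define N where "N = T \<sigma> + \<bar>a\<bar> * T \<mu> + \<bar>b\<bar> * T \<nu>"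
  have near: "\<bar>signed_integral K \<sigma> f - (a * signed_integral K \<mu> f + b * signed_integral K \<nu> f)\<bar> \<le> e * N"
    if e: "0 < e" for e
  proof -
    obtain k :: "'a \<Rightarrow> (('a \<Rightarrow> real) \<Rightarrow> int)" and c where k: "finite (k ` topspace K)" "\<And>j. {x \<in> topspace K. k x = j} \<in> borel_sets K"
      and near: "\<And>x. x \<in> topspace K \<Longrightarrow> \<bar>f x - c (k x)\<bar> \<le> e"
      by (rule step_approximation[OF K f e]) (rule that)
    define R where "R \<rho> = (\<Sum>j \<in> k ` topspace K. c j * \<rho> {x \<in> topspace K. k x = j})" for \<rho> :: "'a set \<Rightarrow> real"
    have R: "\<bar>signed_integral K \<rho> f - R \<rho>\<bar> \<le> e * T \<rho>" if "signed_borel_measure K \<rho>" for \<rho>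
      unfolding R_def T_def by (rule signed_integral_near_step_sum[OF that f, where k=k and c=c and e=e]) (use k near in auto)
    have "R \<sigma> = a * R \<mu> + b * R \<nu>"
      by (simp add: R_def \<sigma>_def algebra_simps sum.distrib sum_distrib_left)
    then have "signed_integral K \<sigma> f - (a * signed_integral K \<mu> f + b * signed_integral K \<nu> f) =
       (signed_integral K \<sigma> f - R \<sigma>) - (a * (signed_integral K \<mu> f - R \<mu>) + b * (signed_integral K \<nu> f - R \<nu>))"
      by (simp add: algebra_simps)
    also have "\<bar>\<dots>\<bar> \<le> \<bar>signed_integral K \<sigma> f - R \<sigma>\<bar> + (\<bar>a\<bar> * \<bar>signed_integral K \<mu> f - R \<mu>\<bar> + \<bar>b\<bar> * \<bar>signed_integral K \<nu> f - R \<nu>\<bar>)"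
      unfolding abs_mult[symmetric] by linarith
    also have "\<dots> \<le> e * T \<sigma> + (\<bar>a\<bar> * (e * T \<mu>) + \<bar>b\<bar> * (e * T \<nu>))"
      by (intro add_mono mult_left_mono R \<sigma> \<mu> \<nu>) auto
    finally show ?thesis by (simp add: N_def algebra_simps)
  qed
  have N: "0 \<le> N" by (simp add: N_def T_def abs_part_nonneg)
  have "\<bar>signed_integral K \<sigma> f - (a * signed_integral K \<mu> f + b * signed_integral K \<nu> f)\<bar> \<le> 0 + e" if e: "0 < e" for e
  proof -
    \<comment> \<open>The \<open>+ 1\<close> covers the case \<open>N = 0\<close>.\<close>
    have "e / (N + 1) * N \<le> e" using N e by (simp add: field_simps)
    then show ?thesis using near[of "e / (N + 1)"] N e by simp
  qed
  then have "\<bar>signed_integral K \<sigma> f - (a * signed_integral K \<mu> f + b * signed_integral K \<nu> f)\<bar> \<le> 0"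
    by (rule field_le_epsilon)
  then show ?thesis by (simp add: \<sigma>_def[abs_def])
qed

text \<open>A partition into one cell with value \<open>0\<close> has step sum \<open>0\<close>, and
  its error bound is the claim.\<close>

lemma signed_integral_bound:
  assumes \<mu>: "signed_borel_measure K \<mu>" and f: "continuous_map K euclideanreal f"
    and C: "\<And>x. x \<in> topspace K \<Longrightarrow> \<bar>f x\<bar> \<le> C"
  shows "\<bar>signed_integral K \<mu> f\<bar> \<le> C * abs_part K \<mu> (topspace K)"
  using signed_integral_near_step_sum[OF \<mu> f, of "\<lambda>_. ()" "\<lambda>_. 0" C] C
  by (simp add: image_constant_conv)

section \<open>Point masses and the transfer of regularity\<close>

definition dirac :: "'b topology \<Rightarrow> 'b \<Rightarrow> 'b set \<Rightarrow> real" where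
  "dirac K x A = (if A \<in> borel_sets K \<and> x \<in> A then 1 else 0)"

lemma signed_borel_dirac: "signed_borel_measure K (dirac K x)"
  unfolding signed_borel_measure_def
proof (intro conjI allI impI)
  fix A :: "nat \<Rightarrow> 'a set" assume A: "range A \<subseteq> borel_sets K \<and> disjoint_family A"
  show "(\<lambda>n. dirac K x (A n)) sums dirac K x (\<Union>n. A n)"
  proof (cases "\<exists>m. x \<in> A m")
    case True
    then obtain m where m: "x \<in> A m" by blast
    have "x \<in> A n \<longleftrightarrow> n = m" for n
      using A m by (auto simp: disjoint_family_on_def)
    moreover have "A n \<in> borel_sets K" for n using A by auto
    ultimately have "(\<lambda>n. dirac K x (A n)) = (\<lambda>n. if n = m then 1 else 0)"
      by (simp add: dirac_def)
    moreover have "dirac K x (\<Union>n. A n) = 1"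
      using A m borel_sets_UN[of A K] by (auto simp: dirac_def)
    ultimately show ?thesis using sums_single[of m "\<lambda>_. 1::real"] by simp
  qed (auto simp: dirac_def)
qed (simp add: dirac_def)

lemma abs_part_dirac: "A \<in> borel_sets K \<Longrightarrow> abs_part K (dirac K x) A = dirac K x A"
  by (rule nonneg_parts[OF signed_borel_dirac]) (simp add: dirac_def)

lemma signed_integral_dirac:
  assumes K: "compact_space K" and x: "x \<in> topspace K" and f: "continuous_map K euclideanreal f"
  shows "signed_integral K (dirac K x) f = f x"
proof -
  have "\<bar>signed_integral K (dirac K x) f - f x\<bar> \<le> 0 + e" if e: "0 < e" for e
  proof -
    have "0 < e/2" using e by simp
    then obtain k :: "'a \<Rightarrow> (('a \<Rightarrow> real) \<Rightarrow> int)" and c where k: "finite (k ` topspace K)" "\<And>j. {x \<in> topspace K. k x = j} \<in> borel_sets K"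
      and near: "\<And>x. x \<in> topspace K \<Longrightarrow> \<bar>f x - c (k x)\<bar> \<le> e/2"
      by (rule step_approximation[OF K f]) (rule that)
    have "(\<Sum>j \<in> k ` topspace K. c j * dirac K x {x \<in> topspace K. k x = j}) = (\<Sum>j \<in> k ` topspace K. if j = k x then c j else 0)"
      using k x by (intro sum.cong) (auto simp: dirac_def)
    also have "\<dots> = c (k x)" using k x by simp
    finally have "(\<Sum>j \<in> k ` topspace K. c j * dirac K x {x \<in> topspace K. k x = j}) = c (k x)" .
    moreover have "\<bar>signed_integral K (dirac K x) f -
        (\<Sum>j \<in> k ` topspace K. c j * dirac K x {x \<in> topspace K. k x = j})\<bar> \<le> e/2 * abs_part K (dirac K x) (topspace K)"
      by (rule signed_integral_near_step_sum[OF signed_borel_dirac f]) (use k near in auto)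
    moreover have "abs_part K (dirac K x) (topspace K) = 1"
      using x by (simp add: abs_part_dirac) (simp add: dirac_def)
    ultimately have "\<bar>signed_integral K (dirac K x) f - c (k x)\<bar> \<le> e/2" by simp
    moreover have "\<bar>f x - c (k x)\<bar> \<le> e/2" by (rule near[OF x])
    ultimately show ?thesis by linarith
  qed
  then have "\<bar>signed_integral K (dirac K x) f - f x\<bar> \<le> 0" by (rule field_le_epsilon)
  then show ?thesis by simp
qed

lemma regular_iff:
  assumes \<mu>: "signed_borel_measure K \<mu>"
  shows "regular_signed_measure K \<mu> \<longleftrightarrow> (\<forall>A \<in> borel_sets K. \<forall>e > 0. \<exists>F G. closedin K F \<and> openin K G \<and> F \<subseteq> A \<and> A \<subseteq> G \<and>
         abs_part K \<mu> (G - F) < e)"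
  by (simp add: regular_signed_measure_def total_variation_eq[OF \<mu>] abs_part_nonneg ennreal_less_iff)

lemma regular_dominated:
  assumes \<mu>: "signed_borel_measure K \<mu>" "regular_signed_measure K \<mu>"
    and \<mu>': "signed_borel_measure K \<mu>'" "regular_signed_measure K \<mu>'" and \<nu>: "signed_borel_measure K \<nu>"
    and dom: "\<And>B. B \<in> borel_sets K \<Longrightarrow> \<bar>\<nu> B\<bar> \<le> C * (abs_part K \<mu> B + abs_part K \<mu>' B)"
    and C: "0 < C"
  shows "regular_signed_measure K \<nu>"
  unfolding regular_iff[OF \<nu>]
proof (intro ballI allI impI)
  fix A and e :: real assume A: "A \<in> borel_sets K" and e: "0 < e"
  \<comment> \<open>Domination costs a factor \<open>2 * C\<close>, and the two regular pairs
    contribute less than \<open>d\<close> each; \<open>4 * C * d = e\<close>.\<close>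
  define d where "d = e / (4 * C)"
  have d: "0 < d" using e C by (simp add: d_def)
  obtain F G where FG: "closedin K F" "openin K G" "F \<subseteq> A" "A \<subseteq> G" "abs_part K \<mu> (G - F) < d"
    using \<mu>(2)[unfolded regular_iff[OF \<mu>(1)]] A d by meson
  obtain F' G' where FG': "closedin K F'" "openin K G'" "F' \<subseteq> A" "A \<subseteq> G'" "abs_part K \<mu>' (G' - F') < d"
    using \<mu>'(2)[unfolded regular_iff[OF \<mu>'(1)]] A d by meson
  define H where "H = G \<inter> G' - (F \<union> F')"
  note [simp] = FG(1,2) FG'(1,2) borel_sets_openin borel_sets_closedin
  have H: "H \<in> borel_sets K"
    unfolding H_def by (intro borel_sets_Diff borel_sets_Int borel_sets_Un) auto
  have "abs_part K \<mu> H \<le> abs_part K \<mu> (G - F)" "abs_part K \<mu>' H \<le> abs_part K \<mu>' (G' - F')"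
    using H by (auto intro!: abs_part_mono \<mu>(1) \<mu>'(1) borel_sets_Diff) (auto simp: H_def)
  then have "abs_part K \<mu> H + abs_part K \<mu>' H < 2 * d" using FG(5) FG'(5) by simp
  then have "2 * C * (abs_part K \<mu> H + abs_part K \<mu>' H) < 2 * C * (2 * d)" using C by simp
  also have "\<dots> = e" using C by (simp add: d_def)
  finally have "abs_part K \<nu> H < e"
    using abs_part_dominated[OF \<mu>(1) \<mu>'(1) \<nu> dom _ H] C by simp
  then show "\<exists>F G. closedin K F \<and> openin K G \<and> F \<subseteq> A \<and> A \<subseteq> G \<and> abs_part K \<nu> (G - F) < e"
    using FG FG' by (intro exI[of _ "F \<union> F'"] exI[of _ "G \<inter> G'"]) (auto simp: H_def)
qed

text \<open>\<open>{x}\<close> is closed, so \<open>G - F\<close> can always be chosen to miss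
  \<open>x\<close>.\<close>

lemma dirac_in_signed_measures:
  assumes "Hausdorff_space K" and x: "x \<in> topspace K"
  shows "dirac K x \<in> signed_measures K"
proof -
  have cl: "closedin K {x}" using assms by (simp add: closedin_Hausdorff_singleton)
  have "\<exists>F G. closedin K F \<and> openin K G \<and> F \<subseteq> A \<and> A \<subseteq> G \<and> abs_part K (dirac K x) (G - F) < e"
    if A: "A \<in> borel_sets K" and e: "0 < e" for A e
  proof (cases "x \<in> A")
    case True
    then have "abs_part K (dirac K x) (topspace K - {x}) = 0"
      using cl by (subst abs_part_dirac) (auto intro: borel_sets_Diff borel_sets_closedin simp: dirac_def)
    then show ?thesis
      using True cl e borel_sets_subset[OF A] by (intro exI[of _ "{x}"] exI[of _ "topspace K"]) auto
  next
    case False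
    then have "abs_part K (dirac K x) (topspace K - {x}) = 0"
      using cl by (subst abs_part_dirac) (auto intro: borel_sets_Diff borel_sets_closedin simp: dirac_def)
    then show ?thesis
      using False cl e borel_sets_subset[OF A] by (intro exI[of _ "{}"] exI[of _ "topspace K - {x}"]) auto
  qed
  then show ?thesis
    by (simp add: signed_measures_def regular_iff signed_borel_dirac)
qed

section \<open>The measure classes over the Stone--Cech compactification\<close>

lemma sc_image_subset_unit_cube: "sc_image X \<subseteq> topspace (unit_cube X)"
proof
  fix y assume "y \<in> sc_image X"
  then obtain x where x: "x \<in> topspace X" "y = sc_map X x" by (auto simp: sc_image_def)
  have "f x \<in> {0..1}" if "f \<in> unit_functions X" for f
    using that x(1) by (auto simp: unit_functions_def dest!: continuous_map_image_subset_topspace)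
  then show "y \<in> topspace (unit_cube X)"
    by (simp add: x(2) unit_cube_def sc_map_def PiE_iff)
qed

lemma compact_space_stone_cech: "compact_space (stone_cech X)"
proof -
  have "compact_space (unit_cube X)"
    unfolding unit_cube_def compact_space_product_topology
    by (auto intro: compact_space_subtopology)
  then show ?thesis
    unfolding stone_cech_def
    by (intro compact_space_subtopology closedin_compact_space closedin_closure_of)
qed

lemma Hausdorff_space_stone_cech: "Hausdorff_space (stone_cech X)"
  unfolding stone_cech_def unit_cube_def
  by (intro Hausdorff_space_subtopology) (auto simp: Hausdorff_space_product_topology Hausdorff_space_subtopology)

lemma sc_image_subset: "sc_image X \<subseteq> topspace (stone_cech X)"
  using closure_of_subset[OF sc_image_subset_unit_cube] sc_image_subset_unit_cube
  by (auto simp: stone_cech_def)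

lemma sc_image_dense:
  assumes "openin (stone_cech X) U" "U \<noteq> {}"
  shows "\<exists>s \<in> sc_image X. s \<in> U"
proof -
  obtain T where T: "openin (unit_cube X) T" "U = T \<inter> unit_cube X closure_of sc_image X"
    using assms(1) unfolding stone_cech_def openin_subtopology by blast
  obtain x where "x \<in> U" using assms(2) by blast
  with T have "x \<in> T" "x \<in> unit_cube X closure_of sc_image X" by auto
  then obtain s where "s \<in> sc_image X" "s \<in> T"
    using T(1) unfolding in_closure_of by blast
  moreover have "sc_image X \<subseteq> unit_cube X closure_of sc_image X"
    by (rule closure_of_subset[OF sc_image_subset_unit_cube])
  ultimately show ?thesis using T(2) by blast
qed

text \<open>Outside the Borel sets \<open>emeasure\<close> is \<open>0\<close> by convention, and so is the total variation.\<close>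

lemma abs_part_notin: "A \<notin> borel_sets K \<Longrightarrow> abs_part K \<mu> A = 0"
  by (simp add: abs_part_def neg_part_def pos_part_def measure_notin_sets)

lemma abs_part_zero: "abs_part K (\<lambda>_. 0) A = 0"
proof (cases "A \<in> borel_sets K")
  case True
  have "signed_borel_measure K (\<lambda>_. 0)" by (simp add: signed_borel_measure_def)
  then show ?thesis using nonneg_parts[of K "\<lambda>_. 0" A] True by simp
qed (rule abs_part_notin)

lemma countable_in_borel_sets:
  assumes "Hausdorff_space K" "countable S" "S \<subseteq> topspace K"
  shows "S \<in> borel_sets K"
proof -
  have "\<Union>((\<lambda>x. {x}) ` S) \<in> borel_sets K"
    using assms by (intro borel_sets_countable_Union)
      (auto intro!: borel_sets_closedin closedin_Hausdorff_singleton)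
  then show ?thesis by simp
qed

lemma sigma_compact_in_borel_sets:
  assumes "Hausdorff_space K" "countable \<K>" "\<And>C. C \<in> \<K> \<Longrightarrow> compactin K C"
  shows "\<Union>\<K> \<in> borel_sets K"
  using assms by (intro borel_sets_countable_Union) (auto intro!: borel_sets_closedin compactin_imp_closedin)

lemma M_class_subset: "M_class p X \<subseteq> signed_measures (stone_cech X)"
  by (cases p) auto

lemma signed_measuresD: "\<mu> \<in> signed_measures K \<Longrightarrow> signed_borel_measure K \<mu>"
  by (simp add: signed_measures_def)

lemma M_classD: "\<mu> \<in> M_class p X \<Longrightarrow> signed_borel_measure (stone_cech X) \<mu>"
  using M_class_subset signed_measuresD by blast

lemma concentrated_on_iff:
  assumes "signed_borel_measure K \<mu>"
  shows "concentrated_on K \<mu> S \<longleftrightarrow> abs_part K \<mu> (topspace K - S) = 0"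
  using abs_part_nonneg[of K \<mu> "topspace K - S"]
  by (auto simp: concentrated_on_def total_variation_eq[OF assms] ennreal_eq_0_iff)

lemma M_class_null_sets:
  assumes \<mu>: "\<mu> \<in> M_class p X" and \<mu>': "\<mu>' \<in> M_class p X" and \<nu>: "\<nu> \<in> signed_measures (stone_cech X)"
    and null: "\<And>A. A \<in> borel_sets (stone_cech X) \<Longrightarrow> abs_part (stone_cech X) \<mu> A = 0 \<Longrightarrow>
        abs_part (stone_cech X) \<mu>' A = 0 \<Longrightarrow> abs_part (stone_cech X) \<nu> A = 0"
  shows "\<nu> \<in> M_class p X"
proof -
  let ?K = "stone_cech X"
  note H = Hausdorff_space_stone_cech[of X]
  note sb = M_classD[OF \<mu>] M_classD[OF \<mu>'] signed_measuresD[OF \<nu>]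
  \<comment> \<open>Stated for all \<open>A\<close>, since a set that is not Borel has variation
    \<open>0\<close> by convention; this lets the classes for sigma and tau be handled
    directly.\<close>
  have tv: "total_variation ?K \<nu> A = 0" if "total_variation ?K \<mu> A = 0" "total_variation ?K \<mu>' A = 0" for A
  proof (cases "A \<in> borel_sets ?K")
    case True
    then show ?thesis
      using that null[OF True] abs_part_nonneg[of ?K \<mu> A] abs_part_nonneg[of ?K \<mu>' A]
      by (simp add: total_variation_eq sb ennreal_eq_0_iff)
  qed (simp add: total_variation_eq sb abs_part_notin)
  \<comment> \<open>Here the sets must be Borel: with the value \<open>0\<close> off the Borel sets,
    monotonicity of the variation can fail.\<close>
  have conc: "concentrated_on ?K \<nu> (S \<union> T)"
    if S: "S \<in> borel_sets ?K" "concentrated_on ?K \<mu> S" and T: "T \<in> borel_sets ?K" "concentrated_on ?K \<mu>' T" for S T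
  proof -
    have D: "topspace ?K - (S \<union> T) \<in> borel_sets ?K"
      using S T by (intro borel_sets_Diff borel_sets_Un) auto
    have "abs_part ?K \<mu> (topspace ?K - (S \<union> T)) \<le> abs_part ?K \<mu> (topspace ?K - S)"
      "abs_part ?K \<mu>' (topspace ?K - (S \<union> T)) \<le> abs_part ?K \<mu>' (topspace ?K - T)"
      using D S T by (auto intro!: abs_part_mono sb borel_sets_Diff)
    then have "abs_part ?K \<mu> (topspace ?K - (S \<union> T)) = 0" "abs_part ?K \<mu>' (topspace ?K - (S \<union> T)) = 0"
      using S(2) T(2) abs_part_nonneg[of ?K] by (auto simp: concentrated_on_iff sb intro: order_antisym)
    then show ?thesis using null[OF D] by (simp add: concentrated_on_iff sb)
  qed
  show ?thesis
  proof (cases p)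
    case Idx_R
    obtain \<K> where \<K>: "countable \<K>" "\<And>C. C \<in> \<K> \<Longrightarrow> compactin ?K C" "\<Union>\<K> \<subseteq> sc_image X" "concentrated_on ?K \<mu> (\<Union>\<K>)"
      using \<mu> Idx_R by auto
    obtain \<K>' where \<K>': "countable \<K>'" "\<And>C. C \<in> \<K>' \<Longrightarrow> compactin ?K C" "\<Union>\<K>' \<subseteq> sc_image X" "concentrated_on ?K \<mu>' (\<Union>\<K>')"
      using \<mu>' Idx_R by auto
    have "concentrated_on ?K \<nu> (\<Union>\<K> \<union> \<Union>\<K>')"
      using \<K> \<K>' by (intro conc sigma_compact_in_borel_sets H)
    then have "concentrated_on ?K \<nu> (\<Union>(\<K> \<union> \<K>'))" by (simp add: Union_Un_distrib)
    then show ?thesis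
      using Idx_R \<nu> \<K> \<K>' by (auto intro!: exI[of _ "\<K> \<union> \<K>'"])
  next
    case Idx_\<beta>
    obtain C where C: "compactin ?K C" "C \<subseteq> sc_image X" "concentrated_on ?K \<mu> C"
      using \<mu> Idx_\<beta> by auto
    obtain C' where C': "compactin ?K C'" "C' \<subseteq> sc_image X" "concentrated_on ?K \<mu>' C'"
      using \<mu>' Idx_\<beta> by auto
    have "concentrated_on ?K \<nu> (C \<union> C')"
      using C C' by (intro conc borel_sets_closedin compactin_imp_closedin H)
    then show ?thesis
      using Idx_\<beta> \<nu> C C' by (auto intro!: exI[of _ "C \<union> C'"] compactin_Un)
  next
    case Idx_d
    obtain S where S: "countable S" "S \<subseteq> sc_image X" "concentrated_on ?K \<mu> S"
      using \<mu> Idx_d by auto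
    obtain S' where S': "countable S'" "S' \<subseteq> sc_image X" "concentrated_on ?K \<mu>' S'"
      using \<mu>' Idx_d by auto
    have "concentrated_on ?K \<nu> (S \<union> S')"
      using S S' sc_image_subset by (intro conc countable_in_borel_sets H) auto
    then show ?thesis
      using Idx_d \<nu> S S' by (auto intro!: exI[of _ "S \<union> S'"])
  qed (use \<mu> \<mu>' \<nu> tv in auto)
qed

lemma M_class_dominated:
  assumes \<mu>: "\<mu> \<in> M_class p X" and \<mu>': "\<mu>' \<in> M_class p X" and \<nu>: "signed_borel_measure (stone_cech X) \<nu>"
    and dom: "\<And>B. B \<in> borel_sets (stone_cech X) \<Longrightarrow>
      \<bar>\<nu> B\<bar> \<le> C * (abs_part (stone_cech X) \<mu> B + abs_part (stone_cech X) \<mu>' B)"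
    and C: "0 < C"
  shows "\<nu> \<in> M_class p X"
proof (rule M_class_null_sets[OF \<mu> \<mu>'])
  have "\<mu> \<in> signed_measures (stone_cech X)" "\<mu>' \<in> signed_measures (stone_cech X)"
    using \<mu> \<mu>' M_class_subset by blast+
  then show "\<nu> \<in> signed_measures (stone_cech X)"
    using regular_dominated[OF _ _ _ _ \<nu> dom C] \<nu> by (simp add: signed_measures_def)
  fix A assume A: "A \<in> borel_sets (stone_cech X)" "abs_part (stone_cech X) \<mu> A = 0" "abs_part (stone_cech X) \<mu>' A = 0"
  have "abs_part (stone_cech X) \<nu> A \<le> 2 * C * (abs_part (stone_cech X) \<mu> A + abs_part (stone_cech X) \<mu>' A)"
    by (rule abs_part_dominated[OF M_classD[OF \<mu>] M_classD[OF \<mu>'] \<nu> dom _ A(1)]) (use C in auto)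
  then show "abs_part (stone_cech X) \<nu> A = 0"
    using A abs_part_nonneg[of "stone_cech X" \<nu> A] by simp
qed

lemma M_class_lincomb:
  assumes \<mu>: "\<mu> \<in> M_class p X" and \<nu>: "\<nu> \<in> M_class p X"
  shows "(\<lambda>A. a * \<mu> A + b * \<nu> A) \<in> M_class p X"
\<comment> \<open>The \<open>1\<close> keeps \<open>C\<close> positive when
  \<open>a = b = 0\<close>.\<close>
proof (rule M_class_dominated[OF \<mu> \<nu>, where C = "1 + \<bar>a\<bar> + \<bar>b\<bar>"])
  show "signed_borel_measure (stone_cech X) (\<lambda>A. a * \<mu> A + b * \<nu> A)"
    by (intro signed_borel_lincomb M_classD[OF \<mu>] M_classD[OF \<nu>])
  fix B
  let ?s = "abs_part (stone_cech X) \<mu> B" and ?t = "abs_part (stone_cech X) \<nu> B"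
  have "\<bar>a * \<mu> B + b * \<nu> B\<bar> \<le> \<bar>a\<bar> * \<bar>\<mu> B\<bar> + \<bar>b\<bar> * \<bar>\<nu> B\<bar>"
    by (metis abs_mult abs_triangle_ineq)
  also have "\<dots> \<le> \<bar>a\<bar> * (?s + ?t) + \<bar>b\<bar> * (?s + ?t)"
    using abs_le_abs_part[OF M_classD[OF \<mu>], of B] abs_le_abs_part[OF M_classD[OF \<nu>], of B]
      abs_part_nonneg[of "stone_cech X" \<mu> B] abs_part_nonneg[of "stone_cech X" \<nu> B]
    by (intro add_mono mult_left_mono) auto
  also have "\<dots> \<le> (1 + \<bar>a\<bar> + \<bar>b\<bar>) * (?s + ?t)"
    using abs_part_nonneg[of "stone_cech X" \<mu> B] abs_part_nonneg[of "stone_cech X" \<nu> B]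
    by (simp add: algebra_simps)
  finally show "\<bar>a * \<mu> B + b * \<nu> B\<bar> \<le> (1 + \<bar>a\<bar> + \<bar>b\<bar>) * (?s + ?t)" .
qed auto

lemma M_class_pos_part:
  assumes \<mu>: "\<mu> \<in> M_class p X"
  shows "pos_part (stone_cech X) \<mu> \<in> M_class p X"
  using signed_borel_pos_part[OF M_classD[OF \<mu>]]
  by (rule M_class_dominated[OF \<mu> \<mu>, where C = 1])
    (simp_all add: abs_part_def pos_part_nonneg neg_part_nonneg add_increasing2)

lemma M_class_neg_part:
  assumes \<mu>: "\<mu> \<in> M_class p X"
  shows "neg_part (stone_cech X) \<mu> \<in> M_class p X"
  using signed_borel_neg_part[OF M_classD[OF \<mu>]]
  by (rule M_class_dominated[OF \<mu> \<mu>, where C = 1])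
    (simp_all add: abs_part_def pos_part_nonneg neg_part_nonneg add_increasing add_increasing2)

lemma zero_in_signed_measures: "(\<lambda>_. 0) \<in> signed_measures K"
proof -
  have z: "signed_borel_measure K (\<lambda>_. 0)" by (simp add: signed_borel_measure_def)
  have "\<exists>F G. closedin K F \<and> openin K G \<and> F \<subseteq> A \<and> A \<subseteq> G" if "A \<in> borel_sets K" for A
    using borel_sets_subset[OF that] by (intro exI[of _ "{}"] exI[of _ "topspace K"]) auto
  then show ?thesis
    by (simp add: signed_measures_def z regular_iff abs_part_zero)
qed

lemma zero_in_M_class: "(\<lambda>_. 0) \<in> M_class p X"
proof -
  have z: "signed_borel_measure (stone_cech X) (\<lambda>_. 0)" by (simp add: signed_borel_measure_def)
  note [simp] = zero_in_signed_measures total_variation_eq[OF z] abs_part_zero concentrated_on_iff[OF z]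
  show ?thesis
    by (cases p) (auto intro: exI[of _ "{}"])
qed

section \<open>Finitely supported measures\<close>

lemma dirac_in_M_class:
  assumes x: "x \<in> sc_image X"
  shows "dirac (stone_cech X) x \<in> M_class p X"
proof -
  let ?K = "stone_cech X"
  have xK: "x \<in> topspace ?K" using x sc_image_subset by blast
  have D: "dirac ?K x \<in> signed_measures ?K"
    by (rule dirac_in_signed_measures[OF Hausdorff_space_stone_cech xK])
  have null: "abs_part ?K (dirac ?K x) A = 0" if "x \<notin> A" for A
    using that by (cases "A \<in> borel_sets ?K") (simp_all add: abs_part_dirac abs_part_notin dirac_def)
  have conc: "concentrated_on ?K (dirac ?K x) {x}"
    by (simp add: concentrated_on_iff signed_borel_dirac null)
  show ?thesis
  proof (cases p)
    case Idx_R
    then show ?thesis using D conc x xK by (auto intro!: exI[of _ "{{x}}"])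
  next
    case Idx_\<beta>
    then show ?thesis using D conc x xK by (auto intro!: exI[of _ "{x}"])
  next
    case Idx_d
    then show ?thesis using D conc x xK by (auto intro!: exI[of _ "{x}"])
  next
    case Idx_a
    then show ?thesis using D by simp
  next
    case Idx: Idx_\<sigma>
    have "x \<notin> C" if "C \<subseteq> topspace ?K - sc_image X" for C using that x by blast
    then show ?thesis using Idx D null by (auto simp: total_variation_eq signed_borel_dirac)
  next
    case Idx: Idx_\<tau>
    have "x \<notin> C" if "C \<subseteq> topspace ?K - sc_image X" for C using that x by blast
    then show ?thesis using Idx D null by (auto simp: total_variation_eq signed_borel_dirac)
  qed
qed

text \<open>Belonging to every class is what lets one density argument serve all \<open>p\<close>.
  Membership and integrals share one induction because additivity of the integral uses that the
  partial sum is a signed measure.\<close>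

lemma finite_support_in_M_class:
  assumes "finite J" "\<And>j. j \<in> J \<Longrightarrow> s j \<in> sc_image X"
  shows "(\<lambda>A. \<Sum>j\<in>J. c j * dirac (stone_cech X) (s j) A) \<in> M_class p X \<and>
    (\<forall>f. continuous_map (stone_cech X) euclideanreal f \<longrightarrow>
      signed_integral (stone_cech X) (\<lambda>A. \<Sum>j\<in>J. c j * dirac (stone_cech X) (s j) A) f = (\<Sum>j\<in>J. c j * f (s j)))"
  using assms
proof (induction J rule: finite_induct)
  case empty
  have "signed_integral (stone_cech X) (\<lambda>_. 0) f = 0" if "continuous_map (stone_cech X) euclideanreal f" for f
    using signed_integral_lincomb[OF compact_space_stone_cech M_classD[OF zero_in_M_class] M_classD[OF zero_in_M_class] that, of 0 0]
    by simp
  then show ?case by (simp add: zero_in_M_class)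
next
  case (insert j J)
  let ?K = "stone_cech X"
  define \<nu> where "\<nu> = (\<lambda>A. \<Sum>j\<in>J. c j * dirac ?K (s j) A)"
  have sj: "s j \<in> sc_image X" using insert.prems by auto
  have \<nu>: "\<nu> \<in> M_class p X" and int: "\<And>f. continuous_map ?K euclideanreal f \<Longrightarrow> signed_integral ?K \<nu> f = (\<Sum>j\<in>J. c j * f (s j))"
    using insert.IH insert.prems by (auto simp: \<nu>_def)
  have eq: "(\<lambda>A. \<Sum>j\<in>insert j J. c j * dirac ?K (s j) A) = (\<lambda>A. c j * dirac ?K (s j) A + 1 * \<nu> A)"
    using insert.hyps by (auto simp: \<nu>_def)
  have "signed_integral ?K (\<lambda>A. c j * dirac ?K (s j) A + 1 * \<nu> A) f = (\<Sum>j\<in>insert j J. c j * f (s j))"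
    if f: "continuous_map ?K euclideanreal f" for f
  proof -
    have "signed_integral ?K (dirac ?K (s j)) f = f (s j)"
      using sj sc_image_subset by (intro signed_integral_dirac compact_space_stone_cech f) auto
    then show ?thesis
      using insert.hyps int[OF f]
      by (subst signed_integral_lincomb[OF compact_space_stone_cech signed_borel_dirac M_classD[OF \<nu>] f]) simp
  qed
  then show ?case
    unfolding eq using M_class_lincomb[OF dirac_in_M_class[OF sj] \<nu>] by blast
qed

section \<open>The weak* topology\<close>

abbreviation weak_star_ball :: "'b topology \<Rightarrow> ('b set \<Rightarrow> real) \<Rightarrow> ('b \<Rightarrow> real) set \<Rightarrow> real \<Rightarrow> ('b set \<Rightarrow> real) set" where
  "weak_star_ball K \<equiv> evaluation_pairing.weak_ball (signed_measures K) (signed_integral K)"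

abbreviation continuous_functions :: "'b topology \<Rightarrow> ('b \<Rightarrow> real) set" where
  "continuous_functions K \<equiv> {f. continuous_map K euclideanreal f}"

lemma mem_weak_star_ball:
  "\<nu> \<in> weak_star_ball K \<mu> F d \<longleftrightarrow> \<nu> \<in> signed_measures K \<and> (\<forall>f\<in>F. \<bar>signed_integral K \<nu> f - signed_integral K \<mu> f\<bar> < d)"
  by (simp add: evaluation_pairing.weak_ball_def)

lemma topspace_weak_star [simp]: "topspace (weak_star_topology K) = signed_measures K"
  by (auto simp: weak_star_topology_def topspace_pullback_topology)

lemma openin_weak_star_ball:
  assumes F: "finite F" "F \<subseteq> continuous_functions K"
  shows "openin (weak_star_topology K) (weak_star_ball K \<mu> F d)"
proof -
  let ?B = "\<lambda>f. if f \<in> F then ball (signed_integral K \<mu> f) d else UNIV"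
  let ?U = "PiE (continuous_functions K) ?B"
  have "{f \<in> continuous_functions K. ?B f \<noteq> UNIV} \<subseteq> F" by auto
  then have "finite {f \<in> continuous_functions K. ?B f \<noteq> UNIV}"
    using F(1) finite_subset by blast
  then have "openin (product_topology (\<lambda>_. euclideanreal) (continuous_functions K)) ?U"
    by (auto simp: openin_PiE_gen)
  moreover have "weak_star_ball K \<mu> F d =
    (\<lambda>\<nu>. \<lambda>f \<in> continuous_functions K. signed_integral K \<nu> f) -` ?U \<inter> signed_measures K"
    using F(2) by (auto simp: mem_weak_star_ball PiE_iff dist_real_def abs_minus_commute subset_iff split: if_splits)
  ultimately show ?thesis
    unfolding weak_star_topology_def openin_pullback_topology by blast
qed

lemma weak_star_ball_base:
  assumes U: "openin (weak_star_topology K) U" "\<mu> \<in> U"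
  obtains F d where "finite F" "F \<subseteq> continuous_functions K" "0 < d" "weak_star_ball K \<mu> F d \<subseteq> U"
proof -
  let ?e = "\<lambda>\<nu>. \<lambda>f \<in> continuous_functions K. signed_integral K \<nu> f"
  obtain V where V: "openin (product_topology (\<lambda>_. euclideanreal) (continuous_functions K)) V"
    "U = ?e -` V \<inter> signed_measures K"
    using U(1) unfolding weak_star_topology_def openin_pullback_topology by blast
  then have "?e \<mu> \<in> V" using U(2) by blast
  then obtain B where fin: "finite {f \<in> continuous_functions K. B f \<noteq> topspace euclideanreal}"
    and B: "\<And>f. f \<in> continuous_functions K \<Longrightarrow> openin euclideanreal (B f)"
    and mem: "?e \<mu> \<in> PiE (continuous_functions K) B" and sub: "PiE (continuous_functions K) B \<subseteq> V"
    using V(1)[unfolded openin_product_topology_alt] by meson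
  define F where "F = {f \<in> continuous_functions K. B f \<noteq> UNIV}"
  have F: "finite F" "F \<subseteq> continuous_functions K"
    using fin by (auto simp: F_def)
  have "\<exists>d>0. \<forall>t. \<bar>t - signed_integral K \<mu> f\<bar> < d \<longrightarrow> t \<in> B f" if "f \<in> F" for f
  proof -
    have f: "f \<in> continuous_functions K" using that F by blast
    have "open (B f)" using B[OF f] by simp
    moreover have "signed_integral K \<mu> f \<in> B f" using mem f by (auto simp: PiE_iff)
    ultimately show ?thesis unfolding open_dist by (auto simp: dist_real_def)
  qed
  then obtain d where d: "\<And>f. f \<in> F \<Longrightarrow> 0 < d f"
    "\<And>f t. f \<in> F \<Longrightarrow> \<bar>t - signed_integral K \<mu> f\<bar> < d f \<Longrightarrow> t \<in> B f"
    by metis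
  \<comment> \<open>The inserted \<open>1\<close> keeps the minimum defined and positive when
    \<open>F\<close> is empty.\<close>
  define d0 where "d0 = Min (insert 1 (d ` F))"
  have d0: "0 < d0" "\<And>f. f \<in> F \<Longrightarrow> d0 \<le> d f"
    using F d by (auto simp: d0_def)
  have "weak_star_ball K \<mu> F d0 \<subseteq> U"
  proof
    fix \<nu> assume \<nu>: "\<nu> \<in> weak_star_ball K \<mu> F d0"
    have "signed_integral K \<nu> f \<in> B f" if f: "f \<in> continuous_functions K" for f
    proof (cases "f \<in> F")
      case True
      then have "\<bar>signed_integral K \<nu> f - signed_integral K \<mu> f\<bar> < d f"
        using \<nu> d0(2)[OF True] by (auto simp: mem_weak_star_ball)
      then show ?thesis using d(2)[OF True] by blast
    next
      case False
      then show ?thesis using f by (simp add: F_def)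
    qed
    then have "?e \<nu> \<in> PiE (continuous_functions K) B" by (simp add: PiE_iff)
    then have "?e \<nu> \<in> V" using sub by blast
    then show "\<nu> \<in> U" unfolding V(2) using \<nu> by (simp add: mem_weak_star_ball)
  qed
  then show thesis using that F d0(1) by blast
qed

text \<open>Bridge from the topology to the epsilon-delta formulation of the first section, used in
  both directions: to read off continuity of a given \<open>f\<close> and to prove continuity of its
  extension.\<close>

lemma continuous_map_weak_star_iff:
  assumes S: "S \<subseteq> signed_measures K"
  shows "continuous_map (subtopology (weak_star_topology K) S) euclideanreal f \<longleftrightarrow>
    evaluation_pairing.weakly_continuous S (signed_integral K) (continuous_functions K) f"
    (is "continuous_map ?W _ _ \<longleftrightarrow> ?R")
proof -
  have ball: "evaluation_pairing.weak_ball S (signed_integral K) \<mu> F d = weak_star_ball K \<mu> F d \<inter> S" for \<mu> F d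
    using S by (auto simp: evaluation_pairing.weak_ball_def)
  show ?thesis
  proof
    assume f: "continuous_map ?W euclideanreal f"
    show ?R
      unfolding evaluation_pairing.weakly_continuous_def
    proof (intro ballI allI impI)
      fix \<mu> and e :: real assume \<mu>: "\<mu> \<in> S" and e: "0 < e"
      have "openin ?W {\<nu> \<in> topspace ?W. f \<nu> \<in> ball (f \<mu>) e}"
        by (rule openin_continuous_map_preimage[OF f]) simp
      then obtain T where T: "openin (weak_star_topology K) T" "{\<nu> \<in> topspace ?W. f \<nu> \<in> ball (f \<mu>) e} = T \<inter> S"
        unfolding openin_subtopology by blast
      have "\<mu> \<in> T" using T(2) \<mu> e S by auto
      then obtain F d where F: "finite F" "F \<subseteq> continuous_functions K" "0 < d" "weak_star_ball K \<mu> F d \<subseteq> T"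
        by (rule weak_star_ball_base[OF T(1)])
      have "\<bar>f \<nu> - f \<mu>\<bar> < e" if "\<nu> \<in> weak_star_ball K \<mu> F d \<inter> S" for \<nu>
      proof -
        have "\<nu> \<in> T \<inter> S" using that F(4) by blast
        then have "f \<nu> \<in> ball (f \<mu>) e" unfolding T(2)[symmetric] by simp
        then show ?thesis by (simp add: dist_real_def abs_minus_commute)
      qed
      then show "\<exists>F d. finite F \<and> F \<subseteq> continuous_functions K \<and> 0 < d \<and>
          (\<forall>\<nu>\<in>evaluation_pairing.weak_ball S (signed_integral K) \<mu> F d. \<bar>f \<nu> - f \<mu>\<bar> < e)"
        unfolding ball using F(1-3) by (intro exI[of _ F] exI[of _ d] conjI ballI)
    qed
  next
    assume R: ?R
    show "continuous_map ?W euclideanreal f"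
      unfolding continuous_map_eq_topcontinuous_at topcontinuous_at_def
    proof (intro ballI conjI allI impI)
      fix \<mu> V assume \<mu>: "\<mu> \<in> topspace ?W" and V: "openin euclideanreal V \<and> f \<mu> \<in> V"
      then obtain e where e: "0 < e" "\<And>t. \<bar>t - f \<mu>\<bar> < e \<Longrightarrow> t \<in> V"
        by (auto simp: open_dist dist_real_def)
      have \<mu>S: "\<mu> \<in> S" "\<mu> \<in> signed_measures K" using \<mu> by auto
      obtain F d where F: "finite F" "F \<subseteq> continuous_functions K" "0 < d"
        "\<forall>\<nu>\<in>weak_star_ball K \<mu> F d \<inter> S. \<bar>f \<nu> - f \<mu>\<bar> < e"
        by (rule evaluation_pairing.weakly_continuousE[OF R \<mu>S(1) e(1), unfolded ball])
      have "openin ?W (weak_star_ball K \<mu> F d \<inter> S)"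
        using openin_weak_star_ball[OF F(1,2)] by (auto simp: openin_subtopology)
      moreover have "\<mu> \<in> weak_star_ball K \<mu> F d \<inter> S"
        using \<mu>S F(3) by (simp add: mem_weak_star_ball)
      moreover have "\<forall>\<nu>\<in>weak_star_ball K \<mu> F d \<inter> S. f \<nu> \<in> V"
        using F(4) e(2) by blast
      ultimately show "\<exists>U. openin ?W U \<and> \<mu> \<in> U \<and> (\<forall>\<nu>\<in>U. f \<nu> \<in> V)" by blast
    qed auto
  qed
qed

lemma continuous_map_signed_integral:
  assumes "continuous_map K euclideanreal f"
  shows "continuous_map (weak_star_topology K) euclideanreal (\<lambda>\<mu>. signed_integral K \<mu> f)"
proof -
  have "evaluation_pairing.weakly_continuous (signed_measures K) (signed_integral K) (continuous_functions K)
     (\<lambda>\<mu>. signed_integral K \<mu> f)"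
    unfolding evaluation_pairing.weakly_continuous_def
  proof (intro ballI allI impI)
    fix \<mu> and e :: real assume "0 < e"
    with assms show "\<exists>F d. finite F \<and> F \<subseteq> continuous_functions K \<and> 0 < d \<and>
       (\<forall>\<nu>\<in>weak_star_ball K \<mu> F d. \<bar>signed_integral K \<nu> f - signed_integral K \<mu> f\<bar> < e)"
      by (intro exI[of _ "{f}"] exI[of _ e]) (simp add: mem_weak_star_ball)
  qed
  then show ?thesis
    using continuous_map_weak_star_iff[of "signed_measures K" K] by (metis order_refl subtopology_topspace topspace_weak_star)
qed

section \<open>Probability measures\<close>

lemma prob_measuresD:
  assumes "\<mu> \<in> prob_measures K"
  shows "\<mu> \<in> signed_measures K" "signed_borel_measure K \<mu>" "\<And>A. A \<in> borel_sets K \<Longrightarrow> 0 \<le> \<mu> A"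
    "\<mu> (topspace K) = 1" "abs_part K \<mu> (topspace K) = 1"
proof -
  show *: "\<mu> \<in> signed_measures K" "\<And>A. A \<in> borel_sets K \<Longrightarrow> 0 \<le> \<mu> A" "\<mu> (topspace K) = 1"
    using assms by (auto simp: prob_measures_def nonneg_measures_def)
  show "signed_borel_measure K \<mu>" by (rule signed_measuresD[OF *(1)])
  then show "abs_part K \<mu> (topspace K) = 1"
    using nonneg_parts[OF _ *(2), where A = "topspace K"] *(3) by simp
qed

text \<open>For the unit ball: an integral is at most the sup-norm times the total variation, which
  is \<open>1\<close>. This inclusion makes the later argument uniform in \<open>Q\<close>.\<close>

lemma prob_measures_subset: "prob_measures K \<subseteq> sub_measures Q K"
proof (cases Q)
  case U_ball
  have "\<mu> \<in> unit_ball_measures K" if \<mu>: "\<mu> \<in> prob_measures K" for \<mu>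
    using prob_measuresD(1)[OF \<mu>] signed_integral_bound[OF prob_measuresD(2)[OF \<mu>], of _ 1] prob_measuresD(5)[OF \<mu>]
    by (auto simp: unit_ball_measures_def)
  with U_ball show ?thesis by auto
qed (auto simp: prob_measures_def)

lemma prob_measures_convex:
  assumes \<mu>: "\<mu> \<in> M_class p X \<inter> prob_measures (stone_cech X)" and \<nu>: "\<nu> \<in> M_class p X \<inter> prob_measures (stone_cech X)"
    and t: "0 \<le> t" "t \<le> 1"
  shows "(\<lambda>A. (1 - t) * \<mu> A + t * \<nu> A) \<in> M_class p X \<inter> prob_measures (stone_cech X)"
proof -
  have "(\<lambda>A. (1 - t) * \<mu> A + t * \<nu> A) \<in> M_class p X"
    using \<mu> \<nu> by (intro M_class_lincomb) auto
  moreover from this have "(\<lambda>A. (1 - t) * \<mu> A + t * \<nu> A) \<in> signed_measures (stone_cech X)"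
    using M_class_subset by blast
  moreover have "0 \<le> (1 - t) * \<mu> A + t * \<nu> A" if "A \<in> borel_sets (stone_cech X)" for A
    using that t prob_measuresD(3)[of \<mu> _ A] prob_measuresD(3)[of \<nu> _ A] \<mu> \<nu> by (intro add_nonneg_nonneg mult_nonneg_nonneg) auto
  moreover have "(1 - t) * \<mu> (topspace (stone_cech X)) + t * \<nu> (topspace (stone_cech X)) = 1"
    using \<mu> \<nu> by (simp add: prob_measuresD(4))
  ultimately show ?thesis
    by (simp add: prob_measures_def nonneg_measures_def)
qed

text \<open>For the constant \<open>1\<close> the step sum has error \<open>0\<close>, so every
  partition sum equals the integral of \<open>1\<close>, and so does the total mass, by the one-cell
  partition.\<close>

lemma sum_partition_prob:
  assumes \<mu>: "\<mu> \<in> prob_measures K"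
    and fin: "finite (k ` topspace K)" and k: "\<And>j. {x \<in> topspace K. k x = j} \<in> borel_sets K"
  shows "(\<Sum>j \<in> k ` topspace K. \<mu> {x \<in> topspace K. k x = j}) = 1"
proof -
  note sb = prob_measuresD(2)[OF \<mu>]
  have one: "continuous_map K euclideanreal (\<lambda>_. 1)" by simp
  \<comment> \<open>The one-cell partition has a cell only if the space is nonempty.\<close>
  have "topspace K \<noteq> {}"
    using prob_measuresD(4)[OF \<mu>] signed_borel_empty[OF sb] by auto
  moreover have "{x \<in> topspace K. True = j} \<in> borel_sets K" for j by (cases j) simp_all
  ultimately have "signed_integral K \<mu> (\<lambda>_. 1) = \<mu> (topspace K)"
    using signed_integral_near_step_sum[OF sb one, where k = "\<lambda>_. True" and c = "\<lambda>_. 1" and e = 0] by (simp add: image_constant_conv)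
  moreover have "signed_integral K \<mu> (\<lambda>_. 1) = (\<Sum>j \<in> k ` topspace K. \<mu> {x \<in> topspace K. k x = j})"
    using signed_integral_near_step_sum[OF sb one fin k, where c = "\<lambda>_. 1" and e = 0] by simp
  ultimately show ?thesis using prob_measuresD(4)[OF \<mu>] by simp
qed

lemma openin_finite_conditions:
  assumes "finite F" "\<And>f. f \<in> F \<Longrightarrow> continuous_map K euclideanreal f"
  shows "openin K {y \<in> topspace K. \<forall>f\<in>F. \<bar>f y - a f\<bar> < (e::real)}"
  using assms
proof (induction F rule: finite_induct)
  case (insert f F)
  have "openin K {y \<in> topspace K. f y \<in> ball (a f) e}"
    by (rule openin_continuous_map_preimage[of K euclideanreal]) (use insert.prems in auto)
  moreover have "{y \<in> topspace K. \<forall>g\<in>insert f F. \<bar>g y - a g\<bar> < e} =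
      {y \<in> topspace K. f y \<in> ball (a f) e} \<inter> {y \<in> topspace K. \<forall>g\<in>F. \<bar>g y - a g\<bar> < e}"
    by (auto simp: dist_real_def abs_minus_commute)
  ultimately show ?case using insert.IH insert.prems by auto
qed simp

text \<open>The mass of each cell of a fine partition of beta X is moved to a point of X near the
  cell for the finitely many test functions; density of X provides it. The result is a convex
  combination of point masses, hence in every class.\<close>

lemma finitely_supported_dense:
  assumes \<mu>: "\<mu> \<in> prob_measures (stone_cech X)"
    and U: "openin (weak_star_topology (stone_cech X)) U" "\<mu> \<in> U"
  shows "\<exists>\<nu> \<in> M_class p X \<inter> prob_measures (stone_cech X). \<nu> \<in> U"
proof -
  let ?K = "stone_cech X"
  obtain F d where F: "finite F" "F \<subseteq> continuous_functions ?K" "0 < d" "weak_star_ball ?K \<mu> F d \<subseteq> U"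
    by (rule weak_star_ball_base[OF U])
  \<comment> \<open>Two errors of size at most \<open>e\<close> add up, from \<open>x\<close> to
    \<open>r (k x)\<close> and from there to \<open>s (k x)\<close>, and
    \<open>2 * e < d\<close>.\<close>
  define e where "e = d / 3"
  have e: "0 < e" using F(3) by (simp add: e_def)
  have Fc: "\<And>f. f \<in> F \<Longrightarrow> continuous_map ?K euclideanreal f" using F(2) by auto
  show ?thesis
  proof (rule small_oscillation_partition[OF compact_space_stone_cech F(1) Fc e])
    fix k :: "(('a \<Rightarrow> real) \<Rightarrow> real) \<Rightarrow> (((('a \<Rightarrow> real) \<Rightarrow> real) \<Rightarrow> real) \<Rightarrow> int)" and r
    assume k: "finite (k ` topspace ?K)" "\<And>j. {x \<in> topspace ?K. k x = j} \<in> borel_sets ?K"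
      and r: "\<And>x. x \<in> topspace ?K \<Longrightarrow> r (k x) \<in> topspace ?K"
      and osc: "\<And>f x. f \<in> F \<Longrightarrow> x \<in> topspace ?K \<Longrightarrow> \<bar>f x - f (r (k x))\<bar> \<le> e"
    define J where "J = k ` topspace ?K"
    have "\<exists>s \<in> sc_image X. \<forall>f\<in>F. \<bar>f s - f (r j)\<bar> < e" if "j \<in> J" for j
    proof -
      have "openin ?K {y \<in> topspace ?K. \<forall>f\<in>F. \<bar>f y - f (r j)\<bar> < e}"
        by (rule openin_finite_conditions[OF F(1) Fc])
      moreover have "r j \<in> {y \<in> topspace ?K. \<forall>f\<in>F. \<bar>f y - f (r j)\<bar> < e}"
        using that r e by (auto simp: J_def)
      ultimately show ?thesis
        using sc_image_dense by blast
    qed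
    then obtain s where s: "\<And>j. j \<in> J \<Longrightarrow> s j \<in> sc_image X" "\<And>j f. j \<in> J \<Longrightarrow> f \<in> F \<Longrightarrow> \<bar>f (s j) - f (r j)\<bar> < e"
      by metis
    define c where "c j = \<mu> {x \<in> topspace ?K. k x = j}" for j
    define \<nu> where "\<nu> = (\<lambda>A. \<Sum>j\<in>J. c j * dirac ?K (s j) A)"
    have J: "finite J" using k(1) by (simp add: J_def)
    have \<nu>: "\<nu> \<in> M_class p X" and int: "\<And>f. continuous_map ?K euclideanreal f \<Longrightarrow> signed_integral ?K \<nu> f = (\<Sum>j\<in>J. c j * f (s j))"
      using finite_support_in_M_class[OF J s(1), where c = c and p = p] by (auto simp: \<nu>_def)
    have \<nu>s: "\<nu> \<in> signed_measures ?K" using \<nu> M_class_subset by blast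
    have "0 \<le> c j" for j using prob_measuresD(3)[OF \<mu> k(2)] by (simp add: c_def)
    then have "0 \<le> \<nu> A" for A by (auto simp: \<nu>_def dirac_def intro!: sum_nonneg)
    moreover have "\<nu> (topspace ?K) = (\<Sum>j\<in>J. c j)"
      unfolding \<nu>_def using s(1) sc_image_subset by (intro sum.cong) (auto simp: dirac_def)
    then have "\<nu> (topspace ?K) = 1"
      using sum_partition_prob[OF \<mu> k] by (simp add: J_def c_def)
    ultimately have P: "\<nu> \<in> prob_measures ?K"
      using \<nu>s by (simp add: prob_measures_def nonneg_measures_def)
    have "\<bar>signed_integral ?K \<nu> f - signed_integral ?K \<mu> f\<bar> < d" if f: "f \<in> F" for f
    proof -
      have "\<bar>signed_integral ?K \<mu> f - (\<Sum>j \<in> k ` topspace ?K. f (s j) * \<mu> {x \<in> topspace ?K. k x = j})\<bar>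
           \<le> (2 * e) * abs_part ?K \<mu> (topspace ?K)"
      proof (rule signed_integral_near_step_sum[OF prob_measuresD(2)[OF \<mu>] Fc[OF f] k])
        fix x assume x: "x \<in> topspace ?K"
        then have "\<bar>f (s (k x)) - f (r (k x))\<bar> < e" using s(2) f by (simp add: J_def)
        with osc[OF f x] show "\<bar>f x - f (s (k x))\<bar> \<le> 2 * e" by linarith
      qed
      then have "\<bar>signed_integral ?K \<mu> f - signed_integral ?K \<nu> f\<bar> \<le> 2 * e"
        by (simp add: int[OF Fc[OF f]] J_def c_def prob_measuresD(5)[OF \<mu>] mult.commute)
      then show ?thesis using e by (simp add: e_def abs_minus_commute)
    qed
    then have "\<nu> \<in> U" using F(4) \<nu>s by (auto simp: mem_weak_star_ball)
    with \<nu> P show ?thesis by blast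
  qed
qed

lemma abs_convex_combination_less:
  fixes x y d t :: real
  assumes "\<bar>x\<bar> < d" "\<bar>y\<bar> < d" "0 \<le> t" "t \<le> 1"
  shows "\<bar>(1 - t) * x + t * y\<bar> < d"
  using convex_bound_lt[of x d y "1 - t" t] convex_bound_lt[of "- x" d "- y" "1 - t" t] assms
  by (simp add: abs_less_iff)

section \<open>The oscillation argument\<close>

lemma oscillation_points:
  assumes "0 < (D::real)"
  obtains a b where "0 < a" "a < b" "b < D" "sin (1 / a) = 1" "sin (1 / b) = -1"
proof -
  \<comment> \<open>This bound makes \<open>u - pi / 2 > (k - 1) * pi \<ge> k - 1 > 1 / D\<close>,
    so that the reciprocal of \<open>u - pi / 2\<close> is below \<open>D\<close>.\<close>
  obtain k where k: "1 + 1 / D < real k" using reals_Archimedean2 by blast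
  define u where "u = 2 * real k * pi"
  have D: "0 < 1 / D" using assms by simp
  have "1 / D < real k - 1" using k by simp
  also have "\<dots> \<le> (real k - 1) * pi"
    using mult_left_mono[of 1 pi "real k - 1"] less_trans[OF D \<open>1 / D < real k - 1\<close>] pi_gt3 by simp
  also have "\<dots> < u - pi / 2"
  proof -
    have "0 < real k" using k D by linarith
    then have "0 < real k * pi" by simp
    then show ?thesis by (simp add: u_def algebra_simps add_pos_pos)
  qed
  finally have u: "1 / D < u - pi / 2" .
  then have pos: "0 < u - pi / 2" "0 < u + pi / 2" using D pi_gt_zero by linarith+
  show thesis
  proof
    show "0 < 1 / (u + pi / 2)" using pos(2) by (rule divide_pos_pos[OF zero_less_one])
    show "1 / (u + pi / 2) < 1 / (u - pi / 2)"
      using pos pi_gt_zero by (intro divide_strict_left_mono mult_pos_pos) linarith+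
    show "1 / (u - pi / 2) < D"
      using less_imp_inverse_less[OF u D] by (simp add: inverse_eq_divide)
    show "sin (1 / (1 / (u + pi / 2))) = 1" "sin (1 / (1 / (u - pi / 2))) = -1"
      by (simp_all add: u_def sin_add sin_diff sin_2npi cos_2npi)
  qed
qed

text \<open>\<open>\<nu>\<close> is found in the Q class, not necessarily among the probability
  measures; only the points that refute an extension are chosen there.\<close>

lemma C_star_embedded_same_integrals:
  fixes \<phi> :: "nat \<Rightarrow> (('a \<Rightarrow> real) \<Rightarrow> real) \<Rightarrow> real"
  assumes emb: "C_star_embedded (subtopology (weak_star_topology (stone_cech X)) (Q_class Q q X)) (Q_class Q p X)"
    and \<mu>: "\<mu> \<in> M_class q X \<inter> prob_measures (stone_cech X)"
    and \<phi>: "\<And>n. continuous_map (stone_cech X) euclideanreal (\<phi> n)"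
  shows "\<exists>\<nu> \<in> Q_class Q p X. \<forall>n. signed_integral (stone_cech X) \<nu> (\<phi> n) = signed_integral (stone_cech X) \<mu> (\<phi> n)"
proof (rule ccontr)
  let ?K = "stone_cech X"
  let ?W = "weak_star_topology ?K"
  let ?Qp = "Q_class Q p X" and ?Qq = "Q_class Q q X"
  let ?Pp = "M_class p X \<inter> prob_measures ?K"
  assume no: "\<not> ?thesis"
  \<comment> \<open>The target \<open>nat \<Rightarrow> real\<close> carries its product metric:
    \<open>D\<close> is continuous because each coordinate is, and it vanishes exactly where all
    integrals agree.\<close>
  define \<Psi> where "\<Psi> \<nu> = (\<lambda>n. signed_integral ?K \<nu> (\<phi> n))" for \<nu>
  define D where "D \<nu> = dist (\<Psi> \<nu>) (\<Psi> \<mu>)" for \<nu>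
  have D_pos: "0 < D \<nu>" if "\<nu> \<in> ?Qp" for \<nu>
    using no that by (auto simp: D_def \<Psi>_def fun_eq_iff)
  have "continuous_map ?W (product_topology (\<lambda>_. euclideanreal) UNIV) \<Psi>"
    unfolding continuous_map_componentwise_UNIV \<Psi>_def
    by (intro allI continuous_map_signed_integral \<phi>)
  then have "continuous_map ?W euclidean \<Psi>" by (simp add: euclidean_product_topology)
  moreover have "continuous_map euclidean euclideanreal (\<lambda>x. dist x (\<Psi> \<mu>))"
    by (simp add: continuous_intros)
  ultimately have "continuous_map ?W euclideanreal ((\<lambda>x. dist x (\<Psi> \<mu>)) \<circ> \<Psi>)"
    by (rule continuous_map_compose)
  then have D_cont: "continuous_map ?W euclideanreal D" by (simp add: o_def D_def[abs_def])
  have Qpq: "?Qp \<subseteq> ?Qq" and Qp: "?Qp \<subseteq> signed_measures ?K"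
    using emb by (auto simp: C_star_embedded_def)
  have sub: "subtopology (subtopology ?W ?Qq) ?Qp = subtopology ?W ?Qp"
    using Qpq by (simp add: subtopology_subtopology Int_absorb1)
  define h where "h \<nu> = sin (1 / D \<nu>)" for \<nu>
  have "continuous_map (subtopology ?W ?Qp) (top_of_set {0<..}) D"
    using D_pos D_cont by (auto simp: continuous_map_in_subtopology continuous_map_from_subtopology)
  moreover have "continuous_map (top_of_set {0::real<..}) euclideanreal (\<lambda>t. sin (1 / t))"
    by (auto simp: continuous_map_iff_continuous intro!: continuous_intros)
  ultimately have "continuous_map (subtopology ?W ?Qp) euclideanreal ((\<lambda>t. sin (1 / t)) \<circ> D)"
    by (rule continuous_map_compose)
  then have h_cont: "continuous_map (subtopology ?W ?Qp) euclideanreal h"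
    by (simp add: o_def h_def[abs_def])
  have "bounded (h ` ?Qp)"
    by (auto simp: bounded_iff h_def intro!: exI[of _ 1])
  with h_cont emb obtain g where g_cont: "continuous_map (subtopology ?W ?Qq) euclideanreal g"
    and g: "\<And>\<nu>. \<nu> \<in> ?Qp \<Longrightarrow> g \<nu> = h \<nu>"
    unfolding C_star_embedded_def sub by blast
  have Pp: "?Pp \<subseteq> ?Qp" using subsetD[OF prob_measures_subset] by (auto simp: Q_class_def)
  have \<mu>s: "\<mu> \<in> signed_measures ?K" and \<mu>P: "\<mu> \<in> prob_measures ?K" and \<mu>Q: "\<mu> \<in> ?Qq"
    using \<mu> prob_measuresD(1) subsetD[OF prob_measures_subset] by (auto simp: Q_class_def)
  \<comment> \<open>Radius \<open>1/2\<close>: the values \<open>1\<close> and \<open>-1\<close> of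
    \<open>h\<close> cannot both lie that close to \<open>g \<mu>\<close>.\<close>
  have "openin (subtopology ?W ?Qq) {\<nu> \<in> topspace (subtopology ?W ?Qq). g \<nu> \<in> ball (g \<mu>) (1/2)}"
    by (rule openin_continuous_map_preimage[OF g_cont]) simp
  then obtain T where T: "openin ?W T" "{\<nu> \<in> topspace (subtopology ?W ?Qq). g \<nu> \<in> ball (g \<mu>) (1/2)} = T \<inter> ?Qq"
    unfolding openin_subtopology by blast
  have "\<mu> \<in> {\<nu> \<in> topspace (subtopology ?W ?Qq). g \<nu> \<in> ball (g \<mu>) (1/2)}"
    using \<mu>s \<mu>Q by simp
  then have "\<mu> \<in> T" unfolding T(2) by blast
  then obtain F d where F: "finite F" "F \<subseteq> continuous_functions ?K" "0 < d" "weak_star_ball ?K \<mu> F d \<subseteq> T"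
    by (rule weak_star_ball_base[OF T(1)])
  define N where "N = weak_star_ball ?K \<mu> F d"
  have N: "openin ?W N" "\<mu> \<in> N"
    using openin_weak_star_ball[OF F(1,2)] \<mu>s F(3) by (auto simp: N_def mem_weak_star_ball)
  have near: "\<bar>h \<nu> - g \<mu>\<bar> < 1/2" if "\<nu> \<in> ?Pp" "\<nu> \<in> N" for \<nu>
  proof -
    have "\<nu> \<in> ?Qp" using that Pp by blast
    moreover from this have "\<nu> \<in> T \<inter> ?Qq" using that(2) F(4) Qpq by (auto simp: N_def)
    then have "g \<nu> \<in> ball (g \<mu>) (1/2)" unfolding T(2)[symmetric] by simp
    ultimately show ?thesis using g by (simp add: dist_real_def abs_minus_commute)
  qed
  \<comment> \<open>The order of choice matters: \<open>\<nu>0\<close> fixes the range below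
    \<open>D \<nu>0\<close>, then \<open>a\<close> and \<open>b\<close> are found in it, and
    \<open>\<nu>1\<close> is taken so near to \<open>\<mu>\<close> that
    \<open>D \<nu>1 < a\<close>.\<close>
  obtain \<nu>0 where \<nu>0: "\<nu>0 \<in> ?Pp" "\<nu>0 \<in> N"
    using finitely_supported_dense[OF \<mu>P N] by blast
  have "0 < D \<nu>0" using D_pos \<nu>0(1) Pp by blast
  then obtain a b where ab: "0 < a" "a < b" "b < D \<nu>0" "sin (1 / a) = 1" "sin (1 / b) = -1"
    by (rule oscillation_points)
  have "openin ?W {\<nu> \<in> topspace ?W. D \<nu> \<in> {..<a}}"
    by (rule openin_continuous_map_preimage[OF D_cont]) simp
  then have "openin ?W (N \<inter> {\<nu> \<in> topspace ?W. D \<nu> \<in> {..<a}})" using N(1) by blast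
  moreover have "\<mu> \<in> N \<inter> {\<nu> \<in> topspace ?W. D \<nu> \<in> {..<a}}"
    using N(2) \<mu>s ab(1) by (simp add: D_def)
  ultimately obtain \<nu>1 where \<nu>1: "\<nu>1 \<in> ?Pp" "\<nu>1 \<in> N" "D \<nu>1 < a"
    using finitely_supported_dense[OF \<mu>P] by blast
  define \<gamma> where "\<gamma> t = (\<lambda>A. (1 - t) * \<nu>1 A + t * \<nu>0 A)" for t
  have \<gamma>_int: "signed_integral ?K (\<gamma> t) f = (1 - t) * signed_integral ?K \<nu>1 f + t * signed_integral ?K \<nu>0 f"
    if "continuous_map ?K euclideanreal f" for t f
    unfolding \<gamma>_def using \<nu>0 \<nu>1
    by (intro signed_integral_lincomb compact_space_stone_cech that) (auto dest: M_classD)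
  \<comment> \<open>The ball \<open>N\<close> and the probability measures of class p are both
    convex, so the segment never leaves the set on which \<open>h\<close> is close to
    \<open>g \<mu>\<close>.\<close>
  have \<gamma>_in: "\<gamma> t \<in> ?Pp \<and> \<gamma> t \<in> N" if t: "0 \<le> t" "t \<le> 1" for t
  proof
    show P: "\<gamma> t \<in> ?Pp" unfolding \<gamma>_def by (rule prob_measures_convex[OF \<nu>1(1) \<nu>0(1) t])
    have "\<bar>signed_integral ?K (\<gamma> t) f - signed_integral ?K \<mu> f\<bar> < d" if f: "f \<in> F" for f
    proof -
      let ?x = "signed_integral ?K \<nu>1 f - signed_integral ?K \<mu> f" and ?y = "signed_integral ?K \<nu>0 f - signed_integral ?K \<mu> f"
      have fc: "continuous_map ?K euclideanreal f" using f F(2) by blast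
      have "\<bar>?x\<bar> < d" "\<bar>?y\<bar> < d"
        using \<nu>1(2) \<nu>0(2) f unfolding N_def mem_weak_star_ball by blast+
      then have "\<bar>(1 - t) * ?x + t * ?y\<bar> < d"
        by (rule abs_convex_combination_less[OF _ _ t])
      moreover have "signed_integral ?K (\<gamma> t) f - signed_integral ?K \<mu> f = (1 - t) * ?x + t * ?y"
        unfolding \<gamma>_int[OF fc] by (simp only: left_diff_distrib right_diff_distrib mult_1)
      ultimately show ?thesis by simp
    qed
    then show "\<gamma> t \<in> N" using P prob_measuresD(1) by (auto simp: N_def mem_weak_star_ball)
  qed
  have \<Psi>\<gamma>: "\<Psi> (\<gamma> t) = (\<lambda>n. (1 - t) * \<Psi> \<nu>1 n + t * \<Psi> \<nu>0 n)" for t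
    by (simp add: \<Psi>_def \<gamma>_int[OF \<phi>])
  have "continuous_on {0..1} (\<lambda>t. (\<lambda>n. (1 - t) * \<Psi> \<nu>1 n + t * \<Psi> \<nu>0 n))"
    by (intro continuous_on_coordinatewise_then_product continuous_intros)
  then have "continuous_on {0..1} (\<lambda>t. dist (\<lambda>n. (1 - t) * \<Psi> \<nu>1 n + t * \<Psi> \<nu>0 n) (\<Psi> \<mu>))"
    by (intro continuous_on_dist continuous_on_const)
  then have cont: "continuous_on {0..1} (\<lambda>t. D (\<gamma> t))"
    by (simp only: D_def \<Psi>\<gamma>)
  have ends: "D (\<gamma> 0) < a" "b < D (\<gamma> 1)" using \<nu>1(3) ab(3) by (simp_all add: \<gamma>_def)
  obtain s where s: "0 \<le> s" "s \<le> 1" "D (\<gamma> s) = a"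
    using IVT'[of "\<lambda>t. D (\<gamma> t)" 0 a 1] ends ab(2) cont by auto
  obtain t where t: "0 \<le> t" "t \<le> 1" "D (\<gamma> t) = b"
    using IVT'[of "\<lambda>t. D (\<gamma> t)" 0 b 1] ends ab(2) cont by auto
  have "h (\<gamma> s) = 1" "h (\<gamma> t) = -1" using s(3) t(3) ab(4,5) by (simp_all add: h_def)
  moreover have "\<bar>h (\<gamma> s) - g \<mu>\<bar> < 1/2" "\<bar>h (\<gamma> t) - g \<mu>\<bar> < 1/2"
    using \<gamma>_in s(1,2) t(1,2) by (blast intro: near)+
  ultimately show False by linarith
qed

section \<open>From probability measures to signed measures\<close>

text \<open>Division by the total mass, with the zero measure set apart. The summand
  \<open>0 * \<mu>' A\<close> gives the shape of \<open>M_class_lincomb\<close> and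
  \<open>signed_integral_lincomb\<close>.\<close>

lemma nonneg_M_class_cases:
  assumes \<mu>: "\<mu> \<in> M_class p X" and nn: "\<And>A. A \<in> borel_sets (stone_cech X) \<Longrightarrow> 0 \<le> \<mu> A"
  obtains "\<mu> = (\<lambda>_. 0)"
  | m \<mu>' where "\<mu>' \<in> M_class p X \<inter> prob_measures (stone_cech X)" "\<mu> = (\<lambda>A. m * \<mu>' A + 0 * \<mu>' A)"
proof -
  let ?K = "stone_cech X"
  define m where "m = \<mu> (topspace ?K)"
  have m: "abs_part ?K \<mu> (topspace ?K) = m"
    using nonneg_parts[OF M_classD[OF \<mu>] nn] by (simp add: m_def)
  show thesis
  proof (cases "m = 0")
    case True
    have "\<mu> A = 0" for A
    proof (cases "A \<in> borel_sets ?K")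
      case A: True
      have "\<bar>\<mu> A\<bar> \<le> abs_part ?K \<mu> A" by (rule abs_le_abs_part[OF M_classD[OF \<mu>]])
      also have "\<dots> \<le> abs_part ?K \<mu> (topspace ?K)"
        using A borel_sets_subset[OF A] by (intro abs_part_mono M_classD[OF \<mu>]) auto
      finally show ?thesis by (simp add: m True)
    next
      case False
      then show ?thesis using M_classD[OF \<mu>] by (simp add: signed_borel_measure_def)
    qed
    then show thesis using that(1) by blast
  next
    case False
    then have "0 < m" using nn[of "topspace ?K"] by (simp add: m_def)
    define \<mu>' where "\<mu>' = (\<lambda>A. (1 / m) * \<mu> A + 0 * \<mu> A)"
    have M: "\<mu>' \<in> M_class p X" unfolding \<mu>'_def by (rule M_class_lincomb[OF \<mu> \<mu>])
    then have "\<mu>' \<in> signed_measures ?K" using M_class_subset by blast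
    then have "\<mu>' \<in> prob_measures ?K"
      using nn \<open>0 < m\<close> by (simp add: prob_measures_def nonneg_measures_def \<mu>'_def) (simp add: m_def)
    moreover have "\<mu> = (\<lambda>A. m * \<mu>' A + 0 * \<mu>' A)"
      using \<open>0 < m\<close> by (simp add: \<mu>'_def)
    ultimately show thesis using that(2) M by blast
  qed
qed

lemma M_class_jordan:
  assumes "\<mu> \<in> M_class p X"
  shows "\<mu> = (\<lambda>A. 1 * pos_part (stone_cech X) \<mu> A + (- 1) * neg_part (stone_cech X) \<mu> A)"
  by (rule ext) (simp add: jordan_decomposition[OF M_classD[OF assms], symmetric])

text \<open>For arbitrary indices the inclusion is not automatic; it comes from the inclusion of the
  Q classes that embedding presupposes, read on probability measures and spread by scaling and
  Jordan decomposition.\<close>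

lemma M_class_mono_of_embedded:
  assumes emb: "C_star_embedded (subtopology (weak_star_topology (stone_cech X)) (Q_class Q q X)) (Q_class Q p X)"
  shows "M_class p X \<subseteq> M_class q X"
proof
  fix \<mu> assume \<mu>: "\<mu> \<in> M_class p X"
  have sub: "M_class p X \<inter> prob_measures (stone_cech X) \<subseteq> M_class q X"
  proof
    fix \<nu> assume "\<nu> \<in> M_class p X \<inter> prob_measures (stone_cech X)"
    then have "\<nu> \<in> Q_class Q p X" using subsetD[OF prob_measures_subset] by (auto simp: Q_class_def)
    then have "\<nu> \<in> Q_class Q q X" using emb by (auto simp: C_star_embedded_def)
    then show "\<nu> \<in> M_class q X" by (simp add: Q_class_def)
  qed
  have nn: "\<nu> \<in> M_class q X" if "\<nu> \<in> M_class p X" "\<And>A. A \<in> borel_sets (stone_cech X) \<Longrightarrow> 0 \<le> \<nu> A" for \<nu>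
  proof (rule nonneg_M_class_cases[OF that])
    assume "\<nu> = (\<lambda>_. 0)"
    then show ?thesis using zero_in_M_class by simp
  next
    fix m \<mu>' assume 2: "\<mu>' \<in> M_class p X \<inter> prob_measures (stone_cech X)" "\<nu> = (\<lambda>A. m * \<mu>' A + 0 * \<mu>' A)"
    then have "\<mu>' \<in> M_class q X" using sub by blast
    then show ?thesis unfolding 2(2) by (intro M_class_lincomb)
  qed
  have "pos_part (stone_cech X) \<mu> \<in> M_class q X" "neg_part (stone_cech X) \<mu> \<in> M_class q X"
    by (rule nn[OF M_class_pos_part[OF \<mu>] pos_part_nonneg] nn[OF M_class_neg_part[OF \<mu>] neg_part_nonneg])+
  then show "\<mu> \<in> M_class q X"
    by (subst M_class_jordan[OF \<mu>]) (rule M_class_lincomb)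
qed

lemma M_class_same_integrals:
  fixes \<phi> :: "nat \<Rightarrow> (('a \<Rightarrow> real) \<Rightarrow> real) \<Rightarrow> real"
  assumes emb: "C_star_embedded (subtopology (weak_star_topology (stone_cech X)) (Q_class Q q X)) (Q_class Q p X)"
    and \<mu>: "\<mu> \<in> M_class q X"
    and \<phi>: "\<And>n. continuous_map (stone_cech X) euclideanreal (\<phi> n)"
  shows "\<exists>\<nu> \<in> M_class p X. \<forall>n. signed_integral (stone_cech X) \<nu> (\<phi> n) = signed_integral (stone_cech X) \<mu> (\<phi> n)"
proof -
  let ?K = "stone_cech X"
  note lin = signed_integral_lincomb[OF compact_space_stone_cech M_classD M_classD \<phi>]
  have nn: "\<exists>\<nu>' \<in> M_class p X. \<forall>n. signed_integral ?K \<nu>' (\<phi> n) = signed_integral ?K \<nu> (\<phi> n)"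
    if "\<nu> \<in> M_class q X" "\<And>A. A \<in> borel_sets ?K \<Longrightarrow> 0 \<le> \<nu> A" for \<nu>
  proof (rule nonneg_M_class_cases[OF that])
    assume "\<nu> = (\<lambda>_. 0)"
    then show ?thesis using zero_in_M_class by blast
  next
    fix m \<mu>' assume 2: "\<mu>' \<in> M_class q X \<inter> prob_measures (stone_cech X)" "\<nu> = (\<lambda>A. m * \<mu>' A + 0 * \<mu>' A)"
    then obtain \<nu>' where \<nu>': "\<nu>' \<in> Q_class Q p X" "\<And>n. signed_integral ?K \<nu>' (\<phi> n) = signed_integral ?K \<mu>' (\<phi> n)"
      using C_star_embedded_same_integrals[OF emb 2(1), of \<phi>] \<phi> by blast
    have M: "\<nu>' \<in> M_class p X" "\<mu>' \<in> M_class q X" using \<nu>'(1) 2(1) by (auto simp: Q_class_def)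
    have "signed_integral ?K (\<lambda>A. m * \<nu>' A + 0 * \<nu>' A) (\<phi> n) = signed_integral ?K \<nu> (\<phi> n)" for n
      unfolding 2(2) lin[OF M(1) M(1)] lin[OF M(2) M(2)] by (simp add: \<nu>'(2))
    then show ?thesis using M_class_lincomb[OF M(1) M(1)] by blast
  qed
  obtain \<alpha> where \<alpha>: "\<alpha> \<in> M_class p X" "\<And>n. signed_integral ?K \<alpha> (\<phi> n) = signed_integral ?K (pos_part ?K \<mu>) (\<phi> n)"
    using nn[OF M_class_pos_part[OF \<mu>] pos_part_nonneg] by blast
  obtain \<beta> where \<beta>: "\<beta> \<in> M_class p X" "\<And>n. signed_integral ?K \<beta> (\<phi> n) = signed_integral ?K (neg_part ?K \<mu>) (\<phi> n)"
    using nn[OF M_class_neg_part[OF \<mu>] neg_part_nonneg] by blast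
  have "signed_integral ?K (\<lambda>A. 1 * \<alpha> A + (- 1) * \<beta> A) (\<phi> n) = signed_integral ?K \<mu> (\<phi> n)" for n
  proof -
    have "signed_integral ?K \<mu> (\<phi> n) =
        signed_integral ?K (\<lambda>A. 1 * pos_part ?K \<mu> A + (- 1) * neg_part ?K \<mu> A) (\<phi> n)"
      by (simp only: M_class_jordan[OF \<mu>, symmetric])
    then show ?thesis
      by (simp only: lin[OF \<alpha>(1) \<beta>(1)] lin[OF M_class_pos_part[OF \<mu>] M_class_neg_part[OF \<mu>]] \<alpha>(2) \<beta>(2))
  qed
  then show ?thesis using M_class_lincomb[OF \<alpha>(1) \<beta>(1)] by blast
qed

lemma weak_linear_space_M_class:
  "weak_linear_space (M_class p X) (continuous_functions (stone_cech X)) (signed_integral (stone_cech X))"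
proof
  fix \<mu> \<nu> and c :: real assume \<mu>: "\<mu> \<in> M_class p X" and \<nu>: "\<nu> \<in> M_class p X"
  have "signed_integral (stone_cech X) (\<lambda>A. 1 * \<mu> A + c * \<nu> A) f =
      signed_integral (stone_cech X) \<mu> f + c * signed_integral (stone_cech X) \<nu> f"
    if "f \<in> continuous_functions (stone_cech X)" for f
    using signed_integral_lincomb[OF compact_space_stone_cech M_classD[OF \<mu>] M_classD[OF \<nu>], of f 1 c] that by simp
  then show "\<exists>\<rho> \<in> M_class p X. \<forall>f \<in> continuous_functions (stone_cech X).
      signed_integral (stone_cech X) \<rho> f = signed_integral (stone_cech X) \<mu> f + c * signed_integral (stone_cech X) \<nu> f"
    by (intro bexI[OF _ M_class_lincomb[OF \<mu> \<nu>, of 1 c]] ballI)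
qed

theorem theorem3:
  fixes X :: "'a topology"
    and p q :: measure_index
    and Q :: sub_functor
  assumes "tychonoff_space X"
    and "universally_Q_star_measurable Q p q X"
  shows "universally_M_measurable p q X"
proof -
  let ?K = "stone_cech X"
  let ?W = "weak_star_topology ?K"
  let ?Mp = "M_class p X" and ?Mq = "M_class q X"
  let ?I = "signed_integral ?K"
  have emb: "C_star_embedded (subtopology ?W (Q_class Q q X)) (Q_class Q p X)"
    using assms(2) by (simp add: universally_Q_star_measurable_def)
  have pq: "?Mp \<subseteq> ?Mq" by (rule M_class_mono_of_embedded[OF emb])
  have sub: "subtopology (subtopology ?W ?Mq) ?Mp = subtopology ?W ?Mp"
    using pq by (simp add: subtopology_subtopology Int_absorb1)
  interpret p: weak_linear_space ?Mp "continuous_functions ?K" ?I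
    by (rule weak_linear_space_M_class)
  have "\<exists>g. continuous_map (subtopology ?W ?Mq) euclideanreal g \<and> (\<forall>\<mu> \<in> ?Mp. g \<mu> = f \<mu>)"
    if f: "continuous_map (subtopology ?W ?Mp) euclideanreal f" for f
  proof -
    have "p.weakly_continuous (continuous_functions ?K) f"
      using f continuous_map_weak_star_iff[OF M_class_subset] by blast
    then obtain A where A: "countable A" "A \<subseteq> continuous_functions ?K" and fA: "p.weakly_continuous A f"
      using p.weakly_continuous_countable_support by blast
    \<comment> \<open>The zero function makes the set nonempty for \<open>from_nat_into\<close> when
      \<open>A\<close> is empty; agreement on it is trivial.\<close>
    define \<phi> where "\<phi> = from_nat_into (insert (\<lambda>_. 0) A)"
    have range_\<phi>: "range \<phi> = insert (\<lambda>_. 0) A"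
      unfolding \<phi>_def using A(1) by (intro range_from_nat_into) auto
    then have "\<phi> n \<in> insert (\<lambda>_. 0) A" for n by blast
    then have \<phi>: "continuous_map ?K euclideanreal (\<phi> n)" for n
      using A(2) by (metis (mono_tags) continuous_map_const insertE mem_Collect_eq subsetD topspace_euclidean UNIV_I)
    have "\<forall>\<mu> \<in> ?Mq. \<exists>\<nu> \<in> ?Mp. \<forall>n. ?I \<nu> (\<phi> n) = ?I \<mu> (\<phi> n)"
      by (intro ballI M_class_same_integrals[OF emb _ \<phi>])
    then obtain r where r: "\<And>\<mu>. \<mu> \<in> ?Mq \<Longrightarrow> r \<mu> \<in> ?Mp" "\<And>\<mu> n. \<mu> \<in> ?Mq \<Longrightarrow> ?I (r \<mu>) (\<phi> n) = ?I \<mu> (\<phi> n)"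
      by metis
    have rA: "?I (r \<mu>) a = ?I \<mu> a" if \<mu>: "\<mu> \<in> ?Mq" and a: "a \<in> A" for \<mu> a
    proof -
      obtain n where "a = \<phi> n" using range_\<phi> a by (metis insertCI rangeE)
      then show ?thesis using r(2)[OF \<mu>] by simp
    qed
    \<comment> \<open>\<open>r\<close> is a mere choice function. Continuity survives because
      \<open>f\<close> is controlled by integrals over \<open>A\<close>, and on these
      \<open>r \<mu>\<close> and \<open>\<mu>\<close> agree: \<open>F\<close> and \<open>d\<close>
      for \<open>f\<close> at \<open>r \<mu>\<close> also work at \<open>\<mu>\<close>.\<close>
    have "evaluation_pairing.weakly_continuous ?Mq ?I (continuous_functions ?K) (\<lambda>\<mu>. f (r \<mu>))"
      unfolding evaluation_pairing.weakly_continuous_def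
    proof (intro ballI allI impI)
      fix \<mu> and e :: real assume \<mu>: "\<mu> \<in> ?Mq" and e: "0 < e"
      obtain F d where F: "finite F" "F \<subseteq> A" "0 < d" "\<forall>\<nu> \<in> p.weak_ball (r \<mu>) F d. \<bar>f \<nu> - f (r \<mu>)\<bar> < e"
        by (rule p.weakly_continuousE[OF fA r(1)[OF \<mu>] e])
      have "\<bar>f (r \<nu>) - f (r \<mu>)\<bar> < e" if "\<nu> \<in> evaluation_pairing.weak_ball ?Mq ?I \<mu> F d" for \<nu>
      proof (rule bspec[OF F(4)])
        have \<nu>: "\<nu> \<in> ?Mq" and d: "\<forall>a\<in>F. \<bar>?I \<nu> a - ?I \<mu> a\<bar> < d"
          using that by (simp_all add: evaluation_pairing.weak_ball_def)
        have "\<bar>?I (r \<nu>) a - ?I (r \<mu>) a\<bar> < d" if "a \<in> F" for a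
        proof -
          have "a \<in> A" using that F(2) by blast
          then show ?thesis using bspec[OF d that] by (simp add: rA \<mu> \<nu>)
        qed
        then show "r \<nu> \<in> p.weak_ball (r \<mu>) F d"
          using r(1)[OF \<nu>] by (simp add: p.weak_ball_def)
      qed
      moreover have "F \<subseteq> continuous_functions ?K" using F(2) A(2) by (rule order_trans)
      ultimately show "\<exists>F d. finite F \<and> F \<subseteq> continuous_functions ?K \<and> 0 < d \<and>
          (\<forall>\<nu>\<in>evaluation_pairing.weak_ball ?Mq ?I \<mu> F d. \<bar>f (r \<nu>) - f (r \<mu>)\<bar> < e)"
        using F(1,3) by (intro exI[of _ F] exI[of _ d] conjI ballI)
    qed
    then have "continuous_map (subtopology ?W ?Mq) euclideanreal (\<lambda>\<mu>. f (r \<mu>))"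
      using continuous_map_weak_star_iff[OF M_class_subset] by blast
    \<comment> \<open>\<open>r \<mu>\<close> may differ from \<open>\<mu>\<close>, but it lies in
      every ball over \<open>A\<close> around \<open>\<mu>\<close>, and \<open>f\<close> varies by
      less than any prescribed \<open>e\<close> on some such ball.\<close>
    moreover have "f (r \<mu>) = f \<mu>" if \<mu>: "\<mu> \<in> ?Mp" for \<mu>
    proof -
      have \<mu>q: "\<mu> \<in> ?Mq" using \<mu> pq by blast
      have "\<bar>f (r \<mu>) - f \<mu>\<bar> \<le> 0 + e" if e: "0 < e" for e
      proof -
        obtain F d where F: "finite F" "F \<subseteq> A" "0 < d" "\<forall>\<nu> \<in> p.weak_ball \<mu> F d. \<bar>f \<nu> - f \<mu>\<bar> < e"
          by (rule p.weakly_continuousE[OF fA \<mu> e])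
        have "?I (r \<mu>) a = ?I \<mu> a" if "a \<in> F" for a using that F(2) rA[OF \<mu>q] by blast
        then have "r \<mu> \<in> p.weak_ball \<mu> F d"
          using r(1)[OF \<mu>q] F(3) by (simp add: p.weak_ball_def)
        then show ?thesis using bspec[OF F(4)] by fastforce
      qed
      then have "\<bar>f (r \<mu>) - f \<mu>\<bar> \<le> 0" by (rule field_le_epsilon)
      then show ?thesis by simp
    qed
    ultimately show ?thesis by blast
  qed
  moreover have "?Mp \<subseteq> topspace (subtopology ?W ?Mq)"
    using pq M_class_subset by auto
  ultimately show ?thesis
    unfolding universally_M_measurable_def C_embedded_def sub by blast
qed

end
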